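(* Let $c_4,c_5,c_6$ be real constants. The rotational hypersurface $$\Gamma^{s}(s,t,w)=\left(s\cosh t\cosh w,\ s\sinh t,\ s\cosh t\sinh w,\ \pm\int_{1}^{s}\frac{\sqrt{2\left(6c_4c_5x^{3}+c_4\right)}}{\sqrt{12c_4c_5x^{3}+3x+2c_4}}\,dx+c_6\right)$$ has first kind $L_1$-pointwise 1-type Gauss map, i.e. $L_1N^{s}=\mathfrak m N^{s}$, in $\mathbb E_1^4$, where $$\mathfrak m=-\frac{c_4^{2}\sqrt2\,\left(1+12c_5s^{3}\left(1+12c_5s^{3}\right)\right)}{s^{9/2}\sqrt{3c_4\left(1+6c_5s^{3}\right)}}$$ and $$L_1N^{s}=\frac{2\left(1+12c_5s^{3}\left(1+12c_5s^{3}\right)\right)}{-3c_4^{-2}s^{5}}\left(\cosh t\cosh w,\ \sinh t,\ \cosh t\sinh w,\ \frac{\sqrt{12c_4c_5s^{3}+3s+2c_4}}{-\sqrt{2c_4\left(1+6c_5s^{3}\right)}}\right).$$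
   Context: $\mathbb E_1^4$ is $\mathbb R^4$ with the Lorentzian metric $\langle\,,\rangle=-dx_1^2+dx_2^2+dx_3^2+dx_4^2$. The hypersurface is of the form $\Gamma^{s}(s,t,w)=(s\cosh t\cosh w,\,s\sinh t,\,s\cosh t\sinh w,\,f(s))$, $s\in\mathbb R\setminus\{0\}$, obtained by rotating the profile curve $(s,0,0,f(s))$ about the spacelike axis $(0,0,0,1)$, where $f'\neq0$ and $'=d/ds$. Its Gauss map is $N^{s}=-\frac{1}{\sqrt{1-f'^2}}\left(f'\cosh t\cosh w,\ f'\sinh t,\ f'\cosh t\sinh w,\ 1\right)$, with $\langle N^{s},N^{s}\rangle=1$. For an oriented hypersurface $M$ of $\mathbb E_1^4$ with nondegenerate induced metric $g$, unit normal field (Gauss map) $N$, $\varepsilon=\langle N,N\rangle=\pm1$, shape operator $S=-dN$ and principal curvatures $\kappa_1,\kappa_2,\kappa_3$, put $a_1=-(\kappa_1+\kappa_2+\kappa_3)$, $a_2=\kappa_1\kappa_2+\kappa_1\kappa_3+\kappa_2\kappa_3$, $a_3=-\kappa_1\kappa_2\kappa_3$. The operator $L_k$ is $L_k(\varphi)=\mathrm{tr}(P_k\circ\nabla^2\varphi)$ for $\varphi\in C^\infty(M)$, where $P_k$ is the $k$-th Newton transformation associated with $S$ (that is, $P_0=I$, $P_k=a_kI+S\circ P_{k-1}$) and $\nabla^2\varphi$ is the Hessian operator of $\varphi$; $L_k$ acts componentwise on $\mathbb R^4$-valued functions. With $n=3$, $\binom{n}{k}H_k=(-\varepsilon)^ka_k$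 and $C_k=\binom{n}{k+1}(-\varepsilon)^k$, one has $L_kN=-\varepsilon C_k\big(\nabla H_{k+1}+(nH_1H_{k+1}-(n-k-1)H_{k+2})N\big)$, where $\nabla$ is the gradient of $g$. $M$ has first kind $L_k$-pointwise 1-type Gauss map if $L_kN=\mathfrak mN$ for a non-zero smooth function $\mathfrak m$ on $M$.
   Formalization: For the upper sign of ± in the profile, the printed 𝔪 and fourth component of L₁N have the wrong sign; here the leading minus of 𝔪 and the minus in that component's denominator become ∓'s matching sign σ=±1 of the profile (σ=−1 is as printed). s ranges over s>0 where the roots are real and f'≠0. *)

theory Defs
  imports "HOL-Analysis.Analysis"
begin

text \<open>The Lorentzian scalar product of \<open>E\<^sub>1\<^sup>4\<close>; the first coordinate is the timelike one.\<close>

definition lorentz :: "real^4 \<Rightarrow> real^4 \<Rightarrow> real" where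
  "lorentz x y = - (x $ 1 * y $ 1) + x $ 2 * y $ 2 + x $ 3 * y $ 3 + x $ 4 * y $ 4"

definition partial :: "3 \<Rightarrow> (real^3 \<Rightarrow> 'b::real_normed_vector) \<Rightarrow> real^3 \<Rightarrow> 'b" where
  "partial i F p = frechet_derivative F (at p) (axis i 1)"

primrec times_differentiable_on :: "nat \<Rightarrow> (real^3 \<Rightarrow> 'b::real_normed_vector) \<Rightarrow> (real^3) set \<Rightarrow> bool" where
  "times_differentiable_on 0 F U \<longleftrightarrow> continuous_on U F"
| "times_differentiable_on (Suc n) F U \<longleftrightarrow>
     (\<forall>p\<in>U. F differentiable (at p)) \<and> (\<forall>i. times_differentiable_on n (partial i F) U)"

definition smooth_fun_on :: "(real^3 \<Rightarrow> 'b::real_normed_vector) \<Rightarrow> (real^3) set \<Rightarrow> bool" where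
  "smooth_fun_on F U \<longleftrightarrow> (\<forall>n. times_differentiable_on n F U)"

text \<open>
  A hypersurface is given by a parametrization \<open>X\<close> on an open set \<open>U\<close> of parameters, and all
  geometric objects on it are expressed in these coordinates: functions on the hypersurface are
  functions of the parameter \<open>p\<close>, and tangent vectors are written in the basis of the
  \<open>partial i X p\<close>.
\<close>

definition metric :: "(real^3 \<Rightarrow> real^4) \<Rightarrow> real^3 \<Rightarrow> real^3^3" where
  "metric X p = (\<chi> i j. lorentz (partial i X p) (partial j X p))"

definition oriented_hypersurface :: "(real^3) set \<Rightarrow> (real^3 \<Rightarrow> real^4) \<Rightarrow> (real^3 \<Rightarrow> real^4) \<Rightarrow> bool" where
  "oriented_hypersurface U X N \<longleftrightarrow>
     open U \<and> smooth_fun_on X U \<and> smooth_fun_on N U \<and>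
     (\<forall>p\<in>U. det (metric X p) \<noteq> 0) \<and>
     (\<forall>p\<in>U. \<forall>i. lorentz (N p) (partial i X p) = 0) \<and>
     (\<exists>\<epsilon>\<in>{1, - 1}. \<forall>p\<in>U. lorentz (N p) (N p) = \<epsilon>)"

text \<open>The matrix of \<open>S = - dN\<close>, where a tangent vector with coordinates \<open>v\<close> is \<open>dX v\<close>.\<close>

definition shape_operator :: "(real^3 \<Rightarrow> real^4) \<Rightarrow> (real^3 \<Rightarrow> real^4) \<Rightarrow> real^3 \<Rightarrow> real^3^3" where
  "shape_operator X N p =
     (THE S. \<forall>v. frechet_derivative X (at p) (S *v v) = - frechet_derivative N (at p) v)"

text \<open>
  The eigenvalues of a matrix with algebraic multiplicity, in an arbitrary order; they are only
  used through symmetric functions. Meaningful when all eigenvalues are real.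
\<close>

definition principal_curvatures :: "real^3^3 \<Rightarrow> real^3" where
  "principal_curvatures S = (SOME \<kappa>. \<forall>x. det (mat x - S) = (\<Prod>i\<in>UNIV. x - \<kappa> $ i))"

definition a_coeff :: "nat \<Rightarrow> real^3^3 \<Rightarrow> real" where
  "a_coeff k S = (let \<kappa> = principal_curvatures S in
     if k = 1 then - (\<kappa> $ 1 + \<kappa> $ 2 + \<kappa> $ 3)
     else if k = 2 then \<kappa> $ 1 * \<kappa> $ 2 + \<kappa> $ 1 * \<kappa> $ 3 + \<kappa> $ 2 * \<kappa> $ 3
     else if k = 3 then - (\<kappa> $ 1 * \<kappa> $ 2 * \<kappa> $ 3)
     else 0)"

primrec newton :: "nat \<Rightarrow> real^3^3 \<Rightarrow> real^3^3" where
  "newton 0 S = mat 1"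
| "newton (Suc k) S = mat (a_coeff (Suc k) S) + S ** newton k S"

definition christoffel :: "(real^3 \<Rightarrow> real^4) \<Rightarrow> 3 \<Rightarrow> 3 \<Rightarrow> 3 \<Rightarrow> real^3 \<Rightarrow> real" where
  "christoffel X k i j p =
     (\<Sum>l\<in>UNIV. matrix_inv (metric X p) $ k $ l *
        (partial i (\<lambda>q. metric X q $ j $ l) p + partial j (\<lambda>q. metric X q $ i $ l) p
          - partial l (\<lambda>q. metric X q $ i $ j) p)) / 2"

definition gradient :: "(real^3 \<Rightarrow> real^4) \<Rightarrow> (real^3 \<Rightarrow> real) \<Rightarrow> real^3 \<Rightarrow> real^3" where
  "gradient X \<phi> p = matrix_inv (metric X p) *v (\<chi> j. partial j \<phi> p)"

text \<open>
  The matrix of the Hessian operator \<open>v \<mapsto> \<nabla>\<^sub>v (gradient \<phi>)\<close>, where \<open>\<nabla>\<close> is the Levi-Civita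
  connection: column \<open>j\<close> is the covariant derivative of the gradient in direction \<open>j\<close>.
\<close>

definition hessian :: "(real^3 \<Rightarrow> real^4) \<Rightarrow> (real^3 \<Rightarrow> real) \<Rightarrow> real^3 \<Rightarrow> real^3^3" where
  "hessian X \<phi> p = (\<chi> i j. partial j (\<lambda>q. gradient X \<phi> q $ i) p
     + (\<Sum>l\<in>UNIV. christoffel X i j l p * gradient X \<phi> p $ l))"

definition L_op :: "nat \<Rightarrow> (real^3 \<Rightarrow> real^4) \<Rightarrow> (real^3 \<Rightarrow> real^4) \<Rightarrow> (real^3 \<Rightarrow> real) \<Rightarrow> real^3 \<Rightarrow> real" where
  "L_op k X N \<phi> p = trace (newton k (shape_operator X N p) ** hessian X \<phi> p)"

definition L_vec :: "nat \<Rightarrow> (real^3 \<Rightarrow> real^4) \<Rightarrow> (real^3 \<Rightarrow> real^4) \<Rightarrow> (real^3 \<Rightarrow> real^4) \<Rightarrow> real^3 \<Rightarrow> real^4" where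
  "L_vec k X N F p = (\<chi> c. L_op k X N (\<lambda>q. F q $ c) p)"

text \<open>A non-zero function \<open>m\<close> is understood to be one without zeros.\<close>

definition first_kind_pointwise_1_type ::
    "nat \<Rightarrow> (real^3) set \<Rightarrow> (real^3 \<Rightarrow> real^4) \<Rightarrow> (real^3 \<Rightarrow> real^4) \<Rightarrow> (real^3 \<Rightarrow> real) \<Rightarrow> bool" where
  "first_kind_pointwise_1_type k U X N m \<longleftrightarrow>
     oriented_hypersurface U X N \<and> smooth_fun_on m U \<and> (\<forall>p\<in>U. m p \<noteq> 0) \<and>
     (\<forall>p\<in>U. L_vec k X N N p = m p *\<^sub>R N p)"

text \<open>The parameter \<open>p\<close> is \<open>(s, t, w)\<close>.\<close>

definition rot_surface :: "(real \<Rightarrow> real) \<Rightarrow> real^3 \<Rightarrow> real^4" where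
  "rot_surface f p = (let s = p $ 1; t = p $ 2; w = p $ 3 in
     vector [s * cosh t * cosh w, s * sinh t, s * cosh t * sinh w, f s])"

definition rot_normal :: "(real \<Rightarrow> real) \<Rightarrow> real^3 \<Rightarrow> real^4" where
  "rot_normal f p = (let s = p $ 1; t = p $ 2; w = p $ 3; f' = deriv f s in
     - (1 / sqrt (1 - f'\<^sup>2)) *\<^sub>R
       vector [f' * cosh t * cosh w, f' * sinh t, f' * cosh t * sinh w, 1])"

text \<open>The choice of the sign in front of the integral is \<open>\<sigma>\<close>. The integral is oriented.\<close>

definition profile :: "real \<Rightarrow> real \<Rightarrow> real \<Rightarrow> real \<Rightarrow> real \<Rightarrow> real" where
  "profile \<sigma> c4 c5 c6 s =
     \<sigma> * (LBINT x=ereal 1..ereal s.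
            sqrt (2 * (6 * c4 * c5 * x ^ 3 + c4)) / sqrt (12 * c4 * c5 * x ^ 3 + 3 * x + 2 * c4)) + c6"

text \<open>
  The values of \<open>s\<close> at which \<open>profile\<close>, its Gauss map and the function \<open>s powr (9 / 2)\<close> are all
  defined over the reals and the derivative of \<open>profile\<close> does not vanish. The quantified condition
  makes the integrand real between \<open>1\<close> and \<open>s\<close>; as \<open>sqrt\<close> is total, it has to be required. The
  set is open, it contains \<open>1\<close> when \<open>c4 * (1 + 6 * c5) > 0\<close>, and it is empty when
  \<open>c4 * (1 + 6 * c5) < 0\<close> or \<open>c4 = 0\<close>.
\<close>

definition profile_domain :: "real \<Rightarrow> real \<Rightarrow> real set" where
  "profile_domain c4 c5 = {s. 0 < s \<and> 0 < c4 * (1 + 6 * c5 * s ^ 3) \<and>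
     (\<forall>x\<in>closed_segment 1 s.
        0 \<le> 2 * (6 * c4 * c5 * x ^ 3 + c4) \<and> 0 < 12 * c4 * c5 * x ^ 3 + 3 * x + 2 * c4)}"

end

theory Submission
  imports Defs
begin

text \<open>
  Put \<open>h = f' / sqrt (1 - f'\<^sup>2)\<close>. The principal curvatures of the hypersurface are \<open>h'\<close>, \<open>h / s\<close>
  and \<open>h / s\<close>, so that \<open>a\<^sub>2 = (s h\<^sup>2)' / s\<^sup>2\<close>. The tangential part of \<open>L\<^sub>1 N\<close> is the gradient of
  \<open>a\<^sub>2\<close> up to sign, hence it vanishes as soon as \<open>s h\<^sup>2\<close> is a cubic \<open>\<alpha> s\<^sup>3 + \<beta>\<close>. For the
  profile in question \<open>h\<^sup>2 = 2 c4 (1 + 6 c5 s\<^sup>3) / (3 s)\<close>. The metric is diagonal in \<open>(s, t, w)\<close> and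
  the components of \<open>N\<close> are products of functions of one variable each, which makes the direct
  evaluation of \<open>L\<^sub>1\<close> on them feasible.
\<close>

subsection \<open>Calculus of smooth functions\<close>

lemma partial_eqI:
  assumes "(F has_derivative F') (at p)"
  shows "partial i F p = F' (axis i 1)"
  using frechet_derivative_at[OF assms] by (simp add: partial_def)

text \<open>Being a derivative at \<open>p\<close> depends only on values near \<open>p\<close>, and
  \<open>frechet_derivative\<close> is a choice among such derivatives; the two choices therefore
  coincide, whether or not a derivative exists.\<close>

lemma partial_transform:
  assumes "open U" "p \<in> U" "\<And>q. q \<in> U \<Longrightarrow> F q = G q"
  shows "partial i F p = partial i G p"
proof -
  have "(F has_derivative D) (at p) \<longleftrightarrow> (G has_derivative D) (at p)" for D
    using has_derivative_transform_within_open[of F D p UNIV U G]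
      has_derivative_transform_within_open[of G D p UNIV U F] assms by auto
  then show ?thesis
    by (simp add: partial_def frechet_derivative_def)
qed

lemma partial_component:
  assumes "F differentiable (at p)"
  shows "partial i (\<lambda>q. F q $ c) p = partial i F p $ c"
proof -
  from assms obtain D where D: "(F has_derivative D) (at p)"
    by (auto simp: differentiable_def)
  from has_derivative_compose[OF this bounded_linear_imp_has_derivative[OF bounded_linear_vec_nth]]
  have "((\<lambda>q. F q $ c) has_derivative (\<lambda>v. D v $ c)) (at p)" .
  from partial_eqI[OF this] partial_eqI[OF D] show ?thesis
    by simp
qed

lemma differentiable_vecI:
  fixes F :: "'a::real_normed_vector \<Rightarrow> real^'n"
  assumes "\<And>c. (\<lambda>q. F q $ c) differentiable (at p)"
  shows "F differentiable (at p)"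
proof -
  have D: "((\<lambda>q. F q $ c) has_derivative frechet_derivative (\<lambda>q. F q $ c) (at p)) (at p)" for c
    using assms by (simp add: frechet_derivative_works)
  have "((\<lambda>q. \<Sum>c\<in>UNIV. F q $ c *\<^sub>R axis c (1::real)) has_derivative
      (\<lambda>v. \<Sum>c\<in>UNIV. frechet_derivative (\<lambda>q. F q $ c) (at p) v *\<^sub>R axis c 1)) (at p)"
    by (intro has_derivative_sum has_derivative_scaleR_left D)
  moreover have "(\<lambda>q. \<Sum>c\<in>UNIV. F q $ c *\<^sub>R axis c 1) = F"
    by (simp add: fun_eq_iff vec_eq_iff axis_def if_distrib cong: if_cong)
  ultimately show ?thesis
    by (auto simp: differentiable_def)
qed

lemma times_differentiable_on_cong:
  assumes "open U" "\<And>q. q \<in> U \<Longrightarrow> F q = G q" "times_differentiable_on n F U"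
  shows "times_differentiable_on n G U"
  using assms(2,3)
proof (induction n arbitrary: F G)
  case 0
  then show ?case
    using continuous_on_cong[of U U F G] by auto
next
  case (Suc n)
  have "G differentiable (at p)" if "p \<in> U" for p
  proof -
    have "F differentiable (at p)"
      using Suc.prems(2) that by simp
    then show ?thesis
      using has_derivative_transform_within_open[OF _ assms(1) that, of F _ UNIV G] Suc.prems(1)
      by (auto simp: differentiable_def)
  qed
  moreover have "times_differentiable_on n (partial i G) U" for i
  proof (rule Suc.IH)
    show "partial i F p = partial i G p" if "p \<in> U" for p
      using assms(1) that Suc.prems(1) by (rule partial_transform)
    show "times_differentiable_on n (partial i F) U"
      using Suc.prems(2) by simp
  qed
  ultimately show ?case
    by simp
qed

text \<open>At order 0 this is the continuity of differentiable functions; higher orders reduce to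
  the partial derivatives.\<close>

lemma times_differentiable_on_Suc_D:
  "times_differentiable_on (Suc n) F U \<Longrightarrow> times_differentiable_on n F U"
proof (induction n arbitrary: F)
  case 0
  then show ?case
    by (auto intro!: continuous_at_imp_continuous_on differentiable_imp_continuous_within)
next
  case (Suc n)
  then show ?case
    \<comment> \<open>Only the outermost layer is unfolded on each side, so that the induction
      hypothesis applies to \<open>partial i F\<close> as it stands.\<close>
    unfolding times_differentiable_on.simps(2)[of "Suc n" F] times_differentiable_on.simps(2)[of n F]
    by blast
qed

lemma times_differentiable_on_SucI:
  assumes "open U" "\<And>p. p \<in> U \<Longrightarrow> F differentiable (at p)"
    and "\<And>i p. p \<in> U \<Longrightarrow> partial i F p = G i p"
    and "\<And>i. times_differentiable_on n (G i) U"
  shows "times_differentiable_on (Suc n) F U"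
proof -
  have "times_differentiable_on n (partial i F) U" for i
    using assms(3) by (intro times_differentiable_on_cong[OF assms(1) _ assms(4)[of i]]) simp
  with assms(2) show ?thesis
    by simp
qed

text \<open>Smooth first partial derivatives give order \<open>Suc n\<close> for every
  \<open>n\<close>; going back down to \<open>n\<close> includes order 0.\<close>

lemma smooth_fun_onI_partial:
  assumes "open U" "\<And>p. p \<in> U \<Longrightarrow> F differentiable (at p)"
    and "\<And>i p. p \<in> U \<Longrightarrow> partial i F p = G i p" "\<And>i. smooth_fun_on (G i) U"
  shows "smooth_fun_on F U"
  unfolding smooth_fun_on_def
proof
  fix n
  have "times_differentiable_on (Suc n) F U"
    using assms by (intro times_differentiable_on_SucI[of U F G]) (auto simp: smooth_fun_on_def)
  then show "times_differentiable_on n F U"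
    by (rule times_differentiable_on_Suc_D)
qed

lemma smooth_fun_on_cong:
  assumes "open U" "\<And>q. q \<in> U \<Longrightarrow> F q = G q" "smooth_fun_on F U"
  shows "smooth_fun_on G U"
  using assms times_differentiable_on_cong[OF assms(1)] by (metis smooth_fun_on_def)

lemma smooth_fun_on_const: "smooth_fun_on (\<lambda>_. c) U"
proof -
  have "times_differentiable_on n (\<lambda>_. c) U" for n
  proof (induction n arbitrary: c)
    case (Suc n)
    have "partial i (\<lambda>_. c) = (\<lambda>_. 0)" for i
      by (auto simp: partial_def)
    with Suc show ?case
      by simp
  qed simp
  then show ?thesis
    by (simp add: smooth_fun_on_def)
qed

lemma smooth_fun_on_coordinate:
  assumes "open U"
  shows "smooth_fun_on (\<lambda>p. p $ i) U"
proof (rule smooth_fun_onI_partial[OF assms])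
  have D: "((\<lambda>p. p $ i) has_derivative (\<lambda>v. v $ i)) (at p)" for p :: "real^3"
    by (intro bounded_linear_imp_has_derivative bounded_linear_vec_nth)
  show "(\<lambda>p. p $ i) differentiable (at p)" for p :: "real^3"
    using D by (auto simp: differentiable_def)
  show "partial j (\<lambda>p. p $ i) p = axis j 1 $ i" for j p
    by (rule partial_eqI[OF D])
qed (rule smooth_fun_on_const)

lemma times_differentiable_on_add:
  assumes "open U" "times_differentiable_on n F U" "times_differentiable_on n G U"
  shows "times_differentiable_on n (\<lambda>p. F p + G p) U"
  using assms(2,3)
proof (induction n arbitrary: F G)
  case (Suc n)
  show ?case
  proof (rule times_differentiable_on_SucI[OF assms(1)])
    show "partial i (\<lambda>p. F p + G p) p = partial i F p + partial i G p" if "p \<in> U" for i p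
      using Suc.prems that
      by (auto simp: partial_def frechet_derivative_works dest!: bspec
          intro: partial_eqI[unfolded partial_def] has_derivative_add)
  qed (use Suc in auto)
qed (auto intro: continuous_on_add)

lemma times_differentiable_on_mult:
  fixes F G :: "real^3 \<Rightarrow> real"
  assumes "open U" "times_differentiable_on n F U" "times_differentiable_on n G U"
  shows "times_differentiable_on n (\<lambda>p. F p * G p) U"
  using assms(2,3)
proof (induction n arbitrary: F G)
  case (Suc n)
  show ?case
  proof (rule times_differentiable_on_SucI[OF assms(1)])
    show "partial i (\<lambda>p. F p * G p) p = F p * partial i G p + partial i F p * G p"
      if "p \<in> U" for i p
      using Suc.prems that
      by (auto simp: partial_def frechet_derivative_works dest!: bspec
          intro: partial_eqI[unfolded partial_def] has_derivative_mult)
    show "times_differentiable_on n (\<lambda>p. F p * partial i G p + partial i F p * G p) U" for i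
      \<comment> \<open>The Leibniz formula also contains \<open>F\<close> and \<open>G\<close>
        undifferentiated, which have to be lowered from order \<open>Suc n\<close> to
        \<open>n\<close>.\<close>
      using Suc.prems times_differentiable_on_Suc_D[OF Suc.prems(1)]
        times_differentiable_on_Suc_D[OF Suc.prems(2)]
      by (intro times_differentiable_on_add[OF assms(1)] Suc.IH) auto
  qed (use Suc.prems in auto)
qed (auto intro: continuous_on_mult)

text \<open>The sequence \<open>g\<close> lists the successive derivatives of the outer function.
  The chain rule replaces \<open>g k\<close> by \<open>g (Suc k)\<close>, so the induction runs over
  all \<open>k\<close> at once.\<close>

lemma times_differentiable_on_compose:
  fixes G :: "real^3 \<Rightarrow> real" and g :: "nat \<Rightarrow> real \<Rightarrow> real"
  assumes "open U" "\<And>k p. p \<in> U \<Longrightarrow> (g k has_real_derivative g (Suc k) (G p)) (at (G p))"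
    and "times_differentiable_on n G U"
  shows "times_differentiable_on n (\<lambda>p. g k (G p)) U"
  using assms(3)
proof (induction n arbitrary: k)
  case 0
  have "isCont (g k) (G p)" if "p \<in> U" for p
    using DERIV_isCont assms(2) that by blast
  then have "continuous_on (G ` U) (g k)"
    by (auto intro!: continuous_at_imp_continuous_on)
  with 0 show ?case
    using continuous_on_compose2[of "G ` U" "g k" U G] by auto
next
  case (Suc n)
  have D: "((\<lambda>p. g k (G p)) has_derivative (\<lambda>v. frechet_derivative G (at p) v * g (Suc k) (G p))) (at p)"
    if "p \<in> U" for p
  proof -
    have "(G has_derivative frechet_derivative G (at p)) (at p)"
      using Suc.prems that by (simp add: frechet_derivative_works)
    from has_derivative_compose[OF this has_field_derivative_imp_has_derivative[OF assms(2)[OF that, of k]]]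
    show ?thesis
      by (simp add: mult.commute)
  qed
  show ?case
  proof (rule times_differentiable_on_SucI[OF assms(1)])
    show "(\<lambda>p. g k (G p)) differentiable at p" if "p \<in> U" for p
      using D[OF that] by (auto simp: differentiable_def)
    show "partial i (\<lambda>p. g k (G p)) p = partial i G p * g (Suc k) (G p)" if "p \<in> U" for i p
      using partial_eqI[OF D[OF that]] by (simp add: partial_def)
    show "times_differentiable_on n (\<lambda>p. partial i G p * g (Suc k) (G p)) U" for i
      using Suc.prems times_differentiable_on_Suc_D[OF Suc.prems]
      by (intro times_differentiable_on_mult[OF assms(1)] Suc.IH) auto
  qed
qed

section \<open>Closure of smoothness under elementary operations\<close>

lemma smooth_fun_on_add:
  "open U \<Longrightarrow> smooth_fun_on F U \<Longrightarrow> smooth_fun_on G U \<Longrightarrow> smooth_fun_on (\<lambda>p. F p + G p) U"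
  by (simp add: smooth_fun_on_def times_differentiable_on_add)

lemma smooth_fun_on_mult:
  fixes F G :: "real^3 \<Rightarrow> real"
  shows "open U \<Longrightarrow> smooth_fun_on F U \<Longrightarrow> smooth_fun_on G U \<Longrightarrow> smooth_fun_on (\<lambda>p. F p * G p) U"
  by (simp add: smooth_fun_on_def times_differentiable_on_mult)

lemma smooth_fun_on_compose:
  fixes G :: "real^3 \<Rightarrow> real" and g :: "nat \<Rightarrow> real \<Rightarrow> real"
  assumes "open U" "\<And>k p. p \<in> U \<Longrightarrow> (g k has_real_derivative g (Suc k) (G p)) (at (G p))"
    and "smooth_fun_on G U"
  shows "smooth_fun_on (\<lambda>p. g 0 (G p)) U"
  using assms times_differentiable_on_compose[of U g G] by (simp add: smooth_fun_on_def)

lemma smooth_fun_on_power: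
  fixes F :: "real^3 \<Rightarrow> real"
  shows "open U \<Longrightarrow> smooth_fun_on F U \<Longrightarrow> smooth_fun_on (\<lambda>p. F p ^ n) U"
  by (induction n) (simp_all add: smooth_fun_on_const smooth_fun_on_mult)

lemma smooth_fun_on_cosh:
  "open U \<Longrightarrow> smooth_fun_on G U \<Longrightarrow> smooth_fun_on (\<lambda>p. cosh (G p :: real)) U"
  by (rule smooth_fun_on_compose[of U "\<lambda>n. if even n then cosh else sinh" G, simplified])
    (auto intro!: derivative_eq_intros)

lemma smooth_fun_on_sinh:
  "open U \<Longrightarrow> smooth_fun_on G U \<Longrightarrow> smooth_fun_on (\<lambda>p. sinh (G p :: real)) U"
  by (rule smooth_fun_on_compose[of U "\<lambda>n. if even n then sinh else cosh" G, simplified])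
    (auto intro!: derivative_eq_intros)

lemma smooth_fun_on_powr:
  fixes a :: real
  assumes "open U" "smooth_fun_on G U" "\<And>p. p \<in> U \<Longrightarrow> 0 < G p"
  shows "smooth_fun_on (\<lambda>p. G p powr a) U"
proof -
  \<comment> \<open>The \<open>n\<close>-th derivative of \<open>x powr a\<close>: a falling
    factorial times a shifted power.\<close>
  let ?g = "\<lambda>n x. (\<Prod>k<n. a - of_nat k) * x powr (a - of_nat n)"
  have "(?g k has_real_derivative ?g (Suc k) x) (at x)" if "0 < x" for k x
    using that by (auto intro!: derivative_eq_intros simp: diff_diff_eq add.commute)
  from smooth_fun_on_compose[of U ?g, OF assms(1) this assms(2)] assms(3) show ?thesis
    by simp
qed

lemma smooth_fun_on_sqrt:
  assumes "open U" "smooth_fun_on G U" "\<And>p. p \<in> U \<Longrightarrow> 0 < G p"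
  shows "smooth_fun_on (\<lambda>p. sqrt (G p)) U"
  using assms(3)
  by (intro smooth_fun_on_cong[OF assms(1) _ smooth_fun_on_powr[OF assms, where a = "1/2"]])
    (auto simp: powr_half_sqrt less_imp_le)

text \<open>The reciprocal of a positive function is its power with exponent
  \<open>- 1\<close>.\<close>

lemma smooth_fun_on_divide:
  assumes "open U" "smooth_fun_on F U" "smooth_fun_on G U" "\<And>p. p \<in> U \<Longrightarrow> 0 < G p"
  shows "smooth_fun_on (\<lambda>p. F p / G p :: real) U"
  using assms(4)
  by (intro smooth_fun_on_cong[OF assms(1) _
        smooth_fun_on_mult[OF assms(1,2) smooth_fun_on_powr[OF assms(1,3,4), where a = "- 1"]]])
    (auto simp: powr_minus divide_inverse less_imp_le)

lemma smooth_fun_on_uminus: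
  fixes F :: "real^3 \<Rightarrow> real"
  shows "open U \<Longrightarrow> smooth_fun_on F U \<Longrightarrow> smooth_fun_on (\<lambda>p. - F p) U"
  using smooth_fun_on_mult[OF _ smooth_fun_on_const[of "- 1"], of U F] by simp

lemma smooth_fun_on_vecI:
  fixes F :: "real^3 \<Rightarrow> real^'n"
  assumes "open U" "\<And>c. smooth_fun_on (\<lambda>p. F p $ c) U"
  shows "smooth_fun_on F U"
proof -
  have "times_differentiable_on n F U" if "\<And>c. times_differentiable_on n (\<lambda>p. F p $ c) U" for n
    using that
  proof (induction n arbitrary: F)
    case 0
    have "F = (\<lambda>p. \<chi> c. F p $ c)"
      by simp
    then show ?case
      using 0 continuous_on_vec_lambda[of U "\<lambda>c p. F p $ c"] by simp
  next
    case (Suc n)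
    have D: "F differentiable (at p)" if "p \<in> U" for p
      using Suc.prems that by (auto intro: differentiable_vecI)
    have "times_differentiable_on n (partial i F) U" for i
    proof (rule Suc.IH)
      fix c
      show "times_differentiable_on n (\<lambda>p. partial i F p $ c) U"
      proof (rule times_differentiable_on_cong[OF assms(1)])
        show "partial i (\<lambda>p. F p $ c) p = partial i F p $ c" if "p \<in> U" for p
          by (rule partial_component[OF D[OF that]])
        show "times_differentiable_on n (partial i (\<lambda>p. F p $ c)) U"
          using Suc.prems[of c] by simp
      qed
    qed
    with D show ?case
      by simp
  qed
  with assms(2) show ?thesis
    by (simp add: smooth_fun_on_def)
qed

subsection \<open>The profile curve\<close>

text \<open>The pointwise conditions at \<open>s\<close> are open by continuity. The condition on
  the whole segment from 1 survives a small move of its endpoint, because the new segment lies in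
  the union of the old one and a ball around \<open>s\<close>.\<close>

lemma profile_domain_ball:
  assumes "s \<in> profile_domain c4 c5"
  obtains \<delta> where "0 < \<delta>" "ball s \<delta> \<subseteq> profile_domain c4 c5"
    and "\<And>x. x \<in> ball s \<delta> \<Longrightarrow> 0 < 12 * c4 * c5 * x ^ 3 + 3 * x + 2 * c4"
proof -
  define V where "V = {x. 0 < x \<and> 0 < c4 * (1 + 6 * c5 * x ^ 3)
    \<and> 0 < 12 * c4 * c5 * x ^ 3 + 3 * x + 2 * c4}"
  have "open V"
    unfolding V_def by (intro open_Collect_conj open_Collect_less continuous_intros)
  moreover have "s \<in> V"
    using assms by (simp add: profile_domain_def V_def)
  ultimately obtain \<delta> where \<delta>: "0 < \<delta>" "ball s \<delta> \<subseteq> V"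
    by (auto elim: openE)
  have "y \<in> profile_domain c4 c5" if "y \<in> ball s \<delta>" for y
  proof -
    have "0 \<le> 2 * (6 * c4 * c5 * x ^ 3 + c4) \<and> 0 < 12 * c4 * c5 * x ^ 3 + 3 * x + 2 * c4"
      if x: "x \<in> closed_segment 1 y" for x
    proof (cases "x \<in> closed_segment 1 s")
      case True
      with assms show ?thesis
        by (simp add: profile_domain_def)
    next
      case False
      then have "x \<in> ball s \<delta>"
        using x \<open>y \<in> ball s \<delta>\<close>
        by (auto simp: closed_segment_eq_real_ivl dist_real_def split: if_splits)
      with \<delta>(2) show ?thesis
        by (auto simp: V_def algebra_simps)
    qed
    with that \<delta>(2) show ?thesis
      unfolding profile_domain_def V_def by blast
  qed
  with \<delta>(2) show ?thesis
    by (intro that[OF \<delta>(1)]) (auto simp: V_def)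
qed

lemma open_profile_domain: "open (profile_domain c4 c5)"
  unfolding open_contains_ball by (meson profile_domain_ball)

text \<open>Fundamental theorem of calculus: the denominator is positive on an interval that
  contains 1 and has \<open>s\<close> in its interior, so the integrand is continuous there.\<close>

lemma profile_deriv:
  assumes "s \<in> profile_domain c4 c5"
  shows "(profile \<sigma> c4 c5 c6 has_real_derivative
    \<sigma> * (sqrt (2 * (6 * c4 * c5 * s ^ 3 + c4)) / sqrt (12 * c4 * c5 * s ^ 3 + 3 * s + 2 * c4))) (at s)"
proof -
  let ?D = "\<lambda>x. 12 * c4 * c5 * x ^ 3 + 3 * x + 2 * c4"
  let ?g = "\<lambda>x. sqrt (2 * (6 * c4 * c5 * x ^ 3 + c4)) / sqrt (?D x)"
  obtain \<delta> where \<delta>: "0 < \<delta>" "\<And>x. x \<in> ball s \<delta> \<Longrightarrow> 0 < ?D x"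
    using profile_domain_ball[OF assms] by metis
  \<comment> \<open>The interval reaches past \<open>s\<close> on both sides, which gives a
    two-sided derivative; half the radius keeps the closed end inside the ball.\<close>
  define a b where "a = min 1 (s - \<delta> / 2)" and "b = max 1 (s + \<delta> / 2)"
  have ab: "a \<le> 1" "1 \<le> b" "a < s" "s < b"
    using \<delta>(1) by (auto simp: a_def b_def)
  have "0 < ?D x" if "x \<in> {a..b}" for x
  proof (cases "x \<in> closed_segment 1 s")
    case True
    with assms show ?thesis
      by (simp add: profile_domain_def)
  next
    case False
    with that \<delta>(1) have "x \<in> ball s \<delta>"
      by (auto simp: closed_segment_eq_real_ivl dist_real_def a_def b_def min_def max_def
          split: if_splits)
    then show ?thesis
      by (rule \<delta>(2))
  qed
  then have "continuous_on {a..b} ?g"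
    by (intro continuous_intros) fastforce
  with ab have "((\<lambda>u. LBINT x=ereal 1..ereal u. ?g x) has_vector_derivative ?g s) (at s within {a..b})"
    by (intro interval_integral_FTC2) auto
  then have "((\<lambda>u. LBINT x=ereal 1..ereal u. ?g x) has_real_derivative ?g s) (at s)"
    using ab by (simp add: has_real_derivative_iff_has_vector_derivative at_within_Icc_at)
  then show ?thesis
    unfolding profile_def[abs_def] by (auto intro!: derivative_eq_intros)
qed

subsection \<open>Diagonal matrices\<close>

definition diag3 :: "real \<Rightarrow> real \<Rightarrow> real \<Rightarrow> real^3^3" where
  "diag3 a b c = (\<chi> i j. if i = j then vector [a, b, c] $ i else 0)"

lemma diag3_nth [simp]:
  "diag3 a b c $ 1 $ 1 = a" "diag3 a b c $ 2 $ 2 = b" "diag3 a b c $ 3 $ 3 = c"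
  "i \<noteq> j \<Longrightarrow> diag3 a b c $ i $ j = 0"
  by (simp_all add: diag3_def)

lemma mat_eq_diag3: "mat x = diag3 x x x"
  by (simp add: vec_eq_iff forall_3 mat_def)

lemma diag3_add: "diag3 a b c + diag3 x y z = diag3 (a + x) (b + y) (c + z)"
  by (simp add: vec_eq_iff forall_3)

lemma diag3_diff: "diag3 a b c - diag3 x y z = diag3 (a - x) (b - y) (c - z)"
  by (simp add: vec_eq_iff forall_3)

lemma diag3_mult: "diag3 a b c ** diag3 x y z = diag3 (a * x) (b * y) (c * z)"
  by (simp add: vec_eq_iff forall_3 matrix_matrix_mult_def sum_3)

lemma diag3_mult_vec: "diag3 a b c *v v = vector [a * v $ 1, b * v $ 2, c * v $ 3]"
  by (simp add: vec_eq_iff forall_3 matrix_vector_mult_def sum_3)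

lemma det_diag3: "det (diag3 a b c) = a * b * c"
  by (simp add: det_3)

lemma trace_diag3_mult: "trace (diag3 a b c ** A) = a * A $ 1 $ 1 + b * A $ 2 $ 2 + c * A $ 3 $ 3"
  by (simp add: trace_def matrix_matrix_mult_def sum_3)

lemma matrix_inv_diag3:
  assumes "a \<noteq> 0" "b \<noteq> 0" "c \<noteq> 0"
  shows "matrix_inv (diag3 a b c) = diag3 (1 / a) (1 / b) (1 / c)" (is "matrix_inv ?A = ?B")
  unfolding matrix_inv_def
proof (rule some_equality)
  show inv: "?A ** ?B = mat 1 \<and> ?B ** ?A = mat 1"
    using assms by (simp add: diag3_mult mat_eq_diag3)
  show "B = ?B" if "?A ** B = mat 1 \<and> B ** ?A = mat 1" for B
  proof -
    have "B = B ** (?A ** ?B)"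
      by (simp only: inv matrix_mul_rid)
    also have "\<dots> = ?B"
      by (simp only: matrix_mul_assoc that matrix_mul_lid)
    finally show ?thesis .
  qed
qed

text \<open>\<open>principal_curvatures\<close> is an arbitrary choice, known only through the
  characteristic polynomial; the sum of the eigenvalues has to be recovered from its
  coefficients.\<close>

lemma a_coeff_1_diag3: "a_coeff 1 (diag3 a b c) = - (a + b + c)"
proof -
  let ?P = "\<lambda>\<kappa> :: real^3. \<forall>x. det (mat x - diag3 a b c) = (\<Prod>i\<in>UNIV. x - \<kappa> $ i)"
  have prod_3: "prod g (UNIV :: 3 set) = g 1 * g 2 * g 3" for g :: "3 \<Rightarrow> real"
    unfolding UNIV_3 by (simp add: mult.assoc)
  define \<kappa> where "\<kappa> = principal_curvatures (diag3 a b c)"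
  have "?P (vector [a, b, c])"
    by (simp add: mat_eq_diag3 diag3_diff det_diag3 prod_3)
  then have "?P \<kappa>"
    unfolding \<kappa>_def principal_curvatures_def by (rule someI)
  then have *: "(x - a) * (x - b) * (x - c) = (x - \<kappa> $ 1) * (x - \<kappa> $ 2) * (x - \<kappa> $ 3)" for x
    by (simp add: mat_eq_diag3 diag3_diff det_diag3 prod_3)
  have "a + b + c = \<kappa> $ 1 + \<kappa> $ 2 + \<kappa> $ 3"
    \<comment> \<open>For a monic cubic \<open>P\<close>, the combination
      \<open>P 1 + P (- 1) - 2 * P 0\<close> is twice the quadratic coefficient.\<close>
    using *[of 1] *[of "- 1"] *[of 0] by algebra
  then show ?thesis
    by (simp add: a_coeff_def \<kappa>_def[symmetric])
qed

subsection \<open>Rotational hypersurfaces\<close>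

lemma vector_4:
  "(vector [a, b, c, d] :: ('a::zero)^4) $ 1 = a"
  "(vector [a, b, c, d] :: ('a::zero)^4) $ 2 = b"
  "(vector [a, b, c, d] :: ('a::zero)^4) $ 3 = c"
  "(vector [a, b, c, d] :: ('a::zero)^4) $ 4 = d"
  by (simp_all add: vector_def)

lemma has_derivative_vector_4:
  fixes F1 F2 F3 F4 :: "'a::real_normed_vector \<Rightarrow> real"
  assumes "(F1 has_derivative D1) (at p)" "(F2 has_derivative D2) (at p)"
    "(F3 has_derivative D3) (at p)" "(F4 has_derivative D4) (at p)"
  shows "((\<lambda>q. vector [F1 q, F2 q, F3 q, F4 q] :: real^4) has_derivative
    (\<lambda>v. vector [D1 v, D2 v, D3 v, D4 v])) (at p)"
proof -
  have *: "(vector [a, b, c, d] :: real^4) =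
      a *\<^sub>R axis 1 1 + b *\<^sub>R axis 2 1 + c *\<^sub>R axis 3 1 + d *\<^sub>R axis 4 1" for a b c d
    by (simp add: vec_eq_iff forall_4 vector_4 axis_def)
  show ?thesis
    unfolding * by (intro has_derivative_add has_derivative_scaleR_left assms)
qed

lemma DERIV_cosh: "(cosh has_real_derivative sinh x) (at x)"
  and DERIV_sinh: "(sinh has_real_derivative cosh x) (at x)"
  by (auto intro!: derivative_eq_intros)

text \<open>The components of the immersion and of the Gauss map, the metric coefficients and the
  gradients met below are all products of this form.\<close>

lemma has_derivative_separated:
  fixes \<psi> a b :: "real \<Rightarrow> real" and p :: "real^3"
  assumes "(\<psi> has_real_derivative \<psi>') (at (p $ 1))" "(a has_real_derivative a') (at (p $ 2))"
    "(b has_real_derivative b') (at (p $ 3))"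
  shows "((\<lambda>q. \<psi> (q $ 1) * a (q $ 2) * b (q $ 3)) has_derivative
    (\<lambda>v. \<psi>' * a (p $ 2) * b (p $ 3) * v $ 1 + \<psi> (p $ 1) * a' * b (p $ 3) * v $ 2
      + \<psi> (p $ 1) * a (p $ 2) * b' * v $ 3)) (at p)"
proof -
  have D: "((\<lambda>q :: real^3. g (q $ i)) has_derivative (\<lambda>v. g' * v $ i)) (at p)"
    if "(g has_real_derivative g') (at (p $ i))" for g g' i
    using has_derivative_compose[OF bounded_linear_imp_has_derivative[OF bounded_linear_vec_nth]
        has_field_derivative_imp_has_derivative[OF that]] .
  have "((\<lambda>q. \<psi> (q $ 1) * a (q $ 2) * b (q $ 3)) has_derivative
    (\<lambda>v. \<psi> (p $ 1) * a (p $ 2) * (b' * v $ 3)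
      + (\<psi> (p $ 1) * (a' * v $ 2) + \<psi>' * v $ 1 * a (p $ 2)) * b (p $ 3))) (at p)"
    by (intro has_derivative_mult D assms)
  then show ?thesis
    by (rule has_derivative_eq_rhs) (simp add: fun_eq_iff algebra_simps)
qed

lemma partial_separated:
  fixes \<psi> a b :: "real \<Rightarrow> real" and p :: "real^3"
  assumes "(\<psi> has_real_derivative \<psi>') (at (p $ 1))" "(a has_real_derivative a') (at (p $ 2))"
    "(b has_real_derivative b') (at (p $ 3))"
  shows "partial 1 (\<lambda>q. \<psi> (q $ 1) * a (q $ 2) * b (q $ 3)) p = \<psi>' * a (p $ 2) * b (p $ 3)"
    and "partial 2 (\<lambda>q. \<psi> (q $ 1) * a (q $ 2) * b (q $ 3)) p = \<psi> (p $ 1) * a' * b (p $ 3)"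
    and "partial 3 (\<lambda>q. \<psi> (q $ 1) * a (q $ 2) * b (q $ 3)) p = \<psi> (p $ 1) * a (p $ 2) * b'"
  using partial_eqI[OF has_derivative_separated[OF assms]] by (simp_all add: axis_def)

text \<open>
  The profile curve is described by \<open>h = f' / sqrt (1 - f'\<^sup>2)\<close>: in terms of \<open>h\<close> the Gauss map is
  \<open>- (h E, sqrt (1 + h\<^sup>2))\<close> with \<open>E = (cosh t cosh w, sinh t, cosh t sinh w)\<close>, and the principal
  curvatures are \<open>h'\<close> and twice \<open>h / s\<close>.
\<close>

locale rotational_hypersurface =
  fixes I :: "real set" and f h h' h'' :: "real \<Rightarrow> real"
  assumes open_I: "open I"
    and pos: "s \<in> I \<Longrightarrow> 0 < s"
    and f_deriv: "s \<in> I \<Longrightarrow> (f has_real_derivative h s / sqrt (1 + (h s)\<^sup>2)) (at s)"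
    and h_deriv: "s \<in> I \<Longrightarrow> (h has_real_derivative h' s) (at s)"
    and h'_deriv: "s \<in> I \<Longrightarrow> (h' has_real_derivative h'' s) (at s)"
begin

definition U :: "(real^3) set" where
  "U = {p. p $ 1 \<in> I}"

abbreviation X :: "real^3 \<Rightarrow> real^4" where
  "X \<equiv> rot_surface f"

abbreviation N :: "real^3 \<Rightarrow> real^4" where
  "N \<equiv> rot_normal f"

lemma open_U: "open U"
proof -
  have "U = (\<lambda>p. p $ 1) -` I"
    by (auto simp: U_def)
  with open_I show ?thesis
    by (simp add: open_vimage_vec_nth)
qed

lemma one_plus_h_sq_pos: "0 < 1 + (h s)\<^sup>2"
  by (simp add: add_pos_nonneg)

text \<open>
  The factors \<open>1\<close> in the following formulas keep every component in the shape
  \<open>\<psi> s * a t * b w\<close> of \<open>has_derivative_separated\<close>.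
\<close>

lemma normal_eq:
  assumes "p \<in> U"
  shows "N p = vector [- h (p $ 1) * cosh (p $ 2) * cosh (p $ 3), - h (p $ 1) * sinh (p $ 2) * 1,
    - h (p $ 1) * cosh (p $ 2) * sinh (p $ 3), - sqrt (1 + (h (p $ 1))\<^sup>2) * 1 * 1]"
proof -
  let ?h = "h (p $ 1)" and ?r = "sqrt (1 + (h (p $ 1))\<^sup>2)"
  have d: "deriv f (p $ 1) = ?h / ?r"
    using assms f_deriv by (simp add: U_def DERIV_imp_deriv)
  have r: "0 < ?r" "?r\<^sup>2 = 1 + ?h\<^sup>2"
    using one_plus_h_sq_pos[of "p $ 1"] by simp_all
  \<comment> \<open>The formula for \<open>f'\<close> in terms of \<open>h\<close> inverts
    \<open>h = f' / sqrt (1 - f'\<^sup>2)\<close>; the normalising factor of the Gauss map becomes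
    \<open>sqrt (1 + h\<^sup>2)\<close>.\<close>
  have "1 - (?h / ?r)\<^sup>2 = (1 / ?r)\<^sup>2"
    using r one_plus_h_sq_pos[of "p $ 1"] by (simp add: power_divide field_simps)
  then have "sqrt (1 - (?h / ?r)\<^sup>2) = 1 / ?r"
    using r by (simp only: real_sqrt_abs) simp
  with d r(1) show ?thesis
    by (simp add: rot_normal_def Let_def vec_eq_iff forall_4 vector_4)
qed

text \<open>The differential of \<open>X\<close>. The factors 0 and 1 are kept so that the term is
  literally what \<open>has_derivative_separated\<close> produces.\<close>

definition dX :: "real^3 \<Rightarrow> real^3 \<Rightarrow> real^4" where
  "dX p v = vector
    [1 * cosh (p $ 2) * cosh (p $ 3) * v $ 1 + p $ 1 * sinh (p $ 2) * cosh (p $ 3) * v $ 2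
       + p $ 1 * cosh (p $ 2) * sinh (p $ 3) * v $ 3,
     1 * sinh (p $ 2) * 1 * v $ 1 + p $ 1 * cosh (p $ 2) * 1 * v $ 2 + p $ 1 * sinh (p $ 2) * 0 * v $ 3,
     1 * cosh (p $ 2) * sinh (p $ 3) * v $ 1 + p $ 1 * sinh (p $ 2) * sinh (p $ 3) * v $ 2
       + p $ 1 * cosh (p $ 2) * cosh (p $ 3) * v $ 3,
     h (p $ 1) / sqrt (1 + (h (p $ 1))\<^sup>2) * 1 * 1 * v $ 1 + f (p $ 1) * 0 * 1 * v $ 2
       + f (p $ 1) * 1 * 0 * v $ 3]"

lemma X_has_derivative:
  assumes "p \<in> U"
  shows "(X has_derivative dX p) (at p)"
proof -
  have "X = (\<lambda>q. vector [q $ 1 * cosh (q $ 2) * cosh (q $ 3), q $ 1 * sinh (q $ 2) * 1,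
      q $ 1 * cosh (q $ 2) * sinh (q $ 3), f (q $ 1) * 1 * 1])"
    by (simp add: fun_eq_iff rot_surface_def Let_def)
  moreover have "p $ 1 \<in> I"
    using assms by (simp add: U_def)
  ultimately show ?thesis
    unfolding dX_def[abs_def]
    by (simp only:) (intro has_derivative_vector_4 has_derivative_separated f_deriv DERIV_ident
        DERIV_const DERIV_cosh DERIV_sinh)
qed

lemma sqrt_h_deriv:
  assumes "s \<in> I"
  shows "((\<lambda>s. - sqrt (1 + (h s)\<^sup>2)) has_real_derivative - (h s * h' s / sqrt (1 + (h s)\<^sup>2))) (at s)"
  using h_deriv[OF assms] one_plus_h_sq_pos[of s]
  by (auto intro!: derivative_eq_intros simp: field_simps)

text \<open>Writing \<open>dN\<close> as minus \<open>dX\<close> of a diagonal map makes the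
  principal curvatures visible. The last component fits because the derivative of
  \<open>sqrt (1 + h\<^sup>2)\<close> is \<open>h'\<close> times \<open>f'\<close>.\<close>

lemma N_has_derivative:
  assumes "p \<in> U"
  shows "(N has_derivative (\<lambda>v. - dX p (vector
    [h' (p $ 1) * v $ 1, h (p $ 1) / p $ 1 * v $ 2, h (p $ 1) / p $ 1 * v $ 3]))) (at p)"
proof -
  let ?s = "p $ 1" and ?t = "p $ 2" and ?w = "p $ 3"
  have s: "?s \<in> I" "0 < ?s"
    using assms pos by (auto simp: U_def)
  have "(N has_derivative (\<lambda>v. vector
      [- h' ?s * cosh ?t * cosh ?w * v $ 1 + - h ?s * sinh ?t * cosh ?w * v $ 2
         + - h ?s * cosh ?t * sinh ?w * v $ 3,
       - h' ?s * sinh ?t * 1 * v $ 1 + - h ?s * cosh ?t * 1 * v $ 2 + - h ?s * sinh ?t * 0 * v $ 3,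
       - h' ?s * cosh ?t * sinh ?w * v $ 1 + - h ?s * sinh ?t * sinh ?w * v $ 2
         + - h ?s * cosh ?t * cosh ?w * v $ 3,
       - (h ?s * h' ?s / sqrt (1 + (h ?s)\<^sup>2)) * 1 * 1 * v $ 1
         + - sqrt (1 + (h ?s)\<^sup>2) * 0 * 1 * v $ 2 + - sqrt (1 + (h ?s)\<^sup>2) * 1 * 0 * v $ 3]))
     (at p)" (is "(N has_derivative ?D) _")
    by (rule has_derivative_transform_within_open[OF _ open_U assms normal_eq[symmetric]],
        intro has_derivative_vector_4 has_derivative_separated DERIV_minus h_deriv sqrt_h_deriv
          DERIV_const DERIV_cosh DERIV_sinh s)
  moreover have "?D = (\<lambda>v. - dX p (vector [h' ?s * v $ 1, h ?s / ?s * v $ 2, h ?s / ?s * v $ 3]))"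
  proof
    fix v
    show "?D v = - dX p (vector [h' ?s * v $ 1, h ?s / ?s * v $ 2, h ?s / ?s * v $ 3])"
      unfolding vec_eq_iff forall_4
      using s by (simp add: vector_4 dX_def field_simps)
  qed
  ultimately show ?thesis
    by simp
qed

section \<open>Induced metric and unit normal\<close>

text \<open>The vector \<open>E\<close> runs through the hyperbolic plane: \<open>E\<close> and its
  derivatives in \<open>t\<close> and \<open>w\<close> are mutually orthogonal with squares -1, 1
  and \<open>(cosh t)\<^sup>2\<close>. Together with the last component, the first coefficient is
  \<open>f'\<^sup>2 - 1\<close>.\<close>

lemma lorentz_dX:
  "lorentz (dX p v) (dX p w) = - 1 / (1 + (h (p $ 1))\<^sup>2) * (v $ 1 * w $ 1)
     + (p $ 1)\<^sup>2 * (v $ 2 * w $ 2) + (p $ 1)\<^sup>2 * (cosh (p $ 2))\<^sup>2 * (v $ 3 * w $ 3)"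
proof -
  define k where "k = h (p $ 1) / sqrt (1 + (h (p $ 1))\<^sup>2)"
  have k: "- 1 / (1 + (h (p $ 1))\<^sup>2) = k\<^sup>2 - 1"
    using one_plus_h_sq_pos[of "p $ 1"] by (simp add: k_def power_divide field_simps)
  have "- ((C * c * v1 + s * S * c * v2 + s * C * z * v3) * (C * c * w1 + s * S * c * w2 + s * C * z * w3))
      + (S * v1 + s * C * v2) * (S * w1 + s * C * w2)
      + (C * z * v1 + s * S * z * v2 + s * C * c * v3) * (C * z * w1 + s * S * z * w2 + s * C * c * w3)
      + (k * v1) * (k * w1)
    = (k\<^sup>2 - 1) * (v1 * w1) + s\<^sup>2 * (v2 * w2) + s\<^sup>2 * C\<^sup>2 * (v3 * w3)"
    if "C\<^sup>2 = S\<^sup>2 + 1" "c\<^sup>2 = z\<^sup>2 + 1" for C S c z s v1 v2 v3 w1 w2 w3 :: real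
    using that by algebra
  from this[OF cosh_square_eq cosh_square_eq] show ?thesis
    unfolding k by (simp add: lorentz_def dX_def vector_4 k_def[symmetric])
qed

lemma lorentz_N_dX:
  assumes "p \<in> U"
  shows "lorentz (N p) (dX p v) = 0"
proof -
  define r where "r = sqrt (1 + (h (p $ 1))\<^sup>2)"
  have r: "0 < r"
    using one_plus_h_sq_pos by (simp add: r_def)
  have "- ((- h * C * c) * (C * c * v1 + s * S * c * v2 + s * C * z * v3))
      + (- h * S) * (S * v1 + s * C * v2)
      + (- h * C * z) * (C * z * v1 + s * S * z * v2 + s * C * c * v3) = h * v1"
    if "C\<^sup>2 = S\<^sup>2 + 1" "c\<^sup>2 = z\<^sup>2 + 1" for C S c z s v1 v2 v3 h :: real
    using that by algebra
  from this[OF cosh_square_eq cosh_square_eq] r show ?thesis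
    by (simp add: lorentz_def normal_eq[OF assms] dX_def vector_4 r_def[symmetric])
qed

lemma lorentz_N_N:
  assumes "p \<in> U"
  shows "lorentz (N p) (N p) = 1"
proof -
  have "- ((- h * C * c) * (- h * C * c)) + (- h * S) * (- h * S) + (- h * C * z) * (- h * C * z) = - (h\<^sup>2)"
    if "C\<^sup>2 = S\<^sup>2 + 1" "c\<^sup>2 = z\<^sup>2 + 1" for C S c z h :: real
    using that by algebra
  from this[OF cosh_square_eq cosh_square_eq] one_plus_h_sq_pos[of "p $ 1"] show ?thesis
    by (simp add: lorentz_def normal_eq[OF assms] vector_4)
qed

lemma partial_X:
  assumes "p \<in> U"
  shows "partial i X p = dX p (axis i 1)"
  by (rule partial_eqI[OF X_has_derivative[OF assms]])

lemma metric_X: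
  assumes "p \<in> U"
  shows "metric X p = diag3 (- 1 / (1 + (h (p $ 1))\<^sup>2)) ((p $ 1)\<^sup>2) ((p $ 1)\<^sup>2 * (cosh (p $ 2))\<^sup>2)"
  by (simp add: vec_eq_iff forall_3 metric_def partial_X[OF assms] lorentz_dX axis_def)

text \<open>The function \<open>f\<close> is known only through its derivative, so its smoothness is
  obtained from that of \<open>h / sqrt (1 + h\<^sup>2)\<close>.\<close>

lemma smooth_X:
  assumes "smooth_fun_on (\<lambda>p. h (p $ 1)) U"
  shows "smooth_fun_on X U"
proof -
  have D: "((\<lambda>p :: real^3. f (p $ 1)) has_derivative (\<lambda>v. h (p $ 1) / sqrt (1 + (h (p $ 1))\<^sup>2) * v $ 1)) (at p)"
    if "p \<in> U" for p
    using has_derivative_compose[OF bounded_linear_imp_has_derivative[OF bounded_linear_vec_nth]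
        has_field_derivative_imp_has_derivative[OF f_deriv]] that by (simp add: U_def)
  have "smooth_fun_on (\<lambda>p. f (p $ 1)) U"
  proof (rule smooth_fun_onI_partial[OF open_U])
    show "(\<lambda>p. f (p $ 1)) differentiable (at p)" if "p \<in> U" for p :: "real^3"
      using D[OF that] by (auto simp: differentiable_def)
    show "partial i (\<lambda>p. f (p $ 1)) p = h (p $ 1) / sqrt (1 + (h (p $ 1))\<^sup>2) * axis i 1 $ 1"
      if "p \<in> U" for i p
      by (rule partial_eqI[OF D[OF that]])
    show "smooth_fun_on (\<lambda>p. h (p $ 1) / sqrt (1 + (h (p $ 1))\<^sup>2) * axis i 1 $ 1) U" for i :: 3
      by (intro smooth_fun_on_mult smooth_fun_on_divide smooth_fun_on_sqrt smooth_fun_on_add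
          smooth_fun_on_power smooth_fun_on_const open_U assms) (simp_all add: one_plus_h_sq_pos)
  qed
  then have "smooth_fun_on (\<lambda>p. X p $ c) U" for c
    unfolding rot_surface_def Let_def
    using exhaust_4[of c]
    by (elim disjE; simp only: vector_4; intro smooth_fun_on_mult smooth_fun_on_cosh
        smooth_fun_on_sinh smooth_fun_on_coordinate open_U)
  then show ?thesis
    by (rule smooth_fun_on_vecI[OF open_U])
qed

lemma smooth_N:
  assumes "smooth_fun_on (\<lambda>p. h (p $ 1)) U"
  shows "smooth_fun_on N U"
proof -
  have "smooth_fun_on (\<lambda>p. vector [- h (p $ 1) * cosh (p $ 2) * cosh (p $ 3),
      - h (p $ 1) * sinh (p $ 2) * 1, - h (p $ 1) * cosh (p $ 2) * sinh (p $ 3),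
      - sqrt (1 + (h (p $ 1))\<^sup>2) * 1 * 1] $ c) U" for c :: 4
    using exhaust_4[of c]
    by (elim disjE; simp only: vector_4; intro smooth_fun_on_mult smooth_fun_on_cosh
        smooth_fun_on_sinh smooth_fun_on_coordinate open_U assms smooth_fun_on_uminus
        smooth_fun_on_sqrt smooth_fun_on_add smooth_fun_on_power smooth_fun_on_const one_plus_h_sq_pos)
  then have "smooth_fun_on (\<lambda>p. N p $ c) U" for c
    by (rule smooth_fun_on_cong[OF open_U, rotated]) (simp add: normal_eq)
  then show ?thesis
    by (rule smooth_fun_on_vecI[OF open_U])
qed

lemma oriented_hypersurface_X:
  assumes "smooth_fun_on (\<lambda>p. h (p $ 1)) U"
  shows "oriented_hypersurface U X N"
  unfolding oriented_hypersurface_def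
proof (intro conjI ballI allI open_U smooth_X smooth_N assms)
  fix p assume p: "p \<in> U"
  then show "det (metric X p) \<noteq> 0"
    using pos[of "p $ 1"] one_plus_h_sq_pos[of "p $ 1"] by (simp add: metric_X det_diag3 U_def)
  show "lorentz (N p) (partial i X p) = 0" for i
    by (simp add: partial_X lorentz_N_dX p)
qed (auto simp: lorentz_N_N)

section \<open>Shape operator and first Newton transformation\<close>

lemma matrix_inv_metric_X:
  assumes "p \<in> U"
  shows "matrix_inv (metric X p) =
    diag3 (- (1 + (h (p $ 1))\<^sup>2)) (1 / (p $ 1)\<^sup>2) (1 / ((p $ 1)\<^sup>2 * (cosh (p $ 2))\<^sup>2))"
  using assms pos[of "p $ 1"] one_plus_h_sq_pos[of "p $ 1"]
  by (simp add: metric_X matrix_inv_diag3 U_def)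

lemma shape_operator_X:
  assumes "p \<in> U"
  shows "shape_operator X N p = diag3 (h' (p $ 1)) (h (p $ 1) / p $ 1) (h (p $ 1) / p $ 1)" (is "_ = ?S")
  unfolding shape_operator_def frechet_derivative_at[OF X_has_derivative[OF assms], symmetric]
    frechet_derivative_at[OF N_has_derivative[OF assms], symmetric]
proof (rule the_equality)
  show S: "\<forall>v. dX p (?S *v v) = - (- dX p (vector
      [h' (p $ 1) * v $ 1, h (p $ 1) / p $ 1 * v $ 2, h (p $ 1) / p $ 1 * v $ 3]))"
    by (simp add: diag3_mult_vec)
  \<comment> \<open>Uniqueness of the shape operator rests on injectivity of \<open>dX p\<close>:
    scalar products with the three coordinate vectors recover \<open>v\<close>, since the metric is
    diagonal with non-zero entries.\<close>
  have inj: "v = w" if "dX p v = dX p w" for v w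
  proof -
    have "lorentz (dX p v) (dX p (axis i 1)) = lorentz (dX p w) (dX p (axis i 1))" for i
      using that by simp
    from this[of 1] this[of 2] this[of 3] show ?thesis
      using assms pos[of "p $ 1"] one_plus_h_sq_pos[of "p $ 1"]
      by (auto simp: lorentz_dX axis_def U_def vec_eq_iff forall_3)
  qed
  show "S' = ?S" if "\<forall>v. dX p (S' *v v) = - (- dX p (vector
      [h' (p $ 1) * v $ 1, h (p $ 1) / p $ 1 * v $ 2, h (p $ 1) / p $ 1 * v $ 3]))" for S'
    using that S inj by (metis matrix_eq)
qed

text \<open>Each entry of \<open>S - (trace S) I\<close> is minus the sum of the other two principal
  curvatures.\<close>

lemma newton_1_X:
  assumes "p \<in> U"
  shows "newton 1 (shape_operator X N p) = diag3 (- 2 * (h (p $ 1) / p $ 1))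
    (- (h' (p $ 1) + h (p $ 1) / p $ 1)) (- (h' (p $ 1) + h (p $ 1) / p $ 1))"
  by (simp add: shape_operator_X[OF assms] mat_eq_diag3 diag3_mult diag3_add
      a_coeff_1_diag3[unfolded One_nat_def] algebra_simps)

section \<open>Metric derivatives, gradients and Hessians\<close>

lemma partial_metric_X:
  assumes "p \<in> U"
  shows "partial i (\<lambda>q. metric X q $ j $ l) p =
    (if i = 1 \<and> j = 1 \<and> l = 1 then 2 * h (p $ 1) * h' (p $ 1) / (1 + (h (p $ 1))\<^sup>2)\<^sup>2
     else if i = 1 \<and> j = 2 \<and> l = 2 then 2 * p $ 1
     else if i = 1 \<and> j = 3 \<and> l = 3 then 2 * p $ 1 * (cosh (p $ 2))\<^sup>2
     else if i = 2 \<and> j = 3 \<and> l = 3 then 2 * (p $ 1)\<^sup>2 * cosh (p $ 2) * sinh (p $ 2)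
     else 0)"
proof -
  have s: "p $ 1 \<in> I"
    using assms by (simp add: U_def)
  have g1: "((\<lambda>s. - 1 / (1 + (h s)\<^sup>2)) has_real_derivative
      2 * h (p $ 1) * h' (p $ 1) / (1 + (h (p $ 1))\<^sup>2)\<^sup>2) (at (p $ 1))"
    using h_deriv[OF s] one_plus_h_sq_pos[of "p $ 1"]
    by (auto intro!: derivative_eq_intros simp: power2_eq_square)
  have one: "((\<lambda>_. 1 :: real) has_real_derivative 0) (at x)" for x
    by simp
  have sq: "((\<lambda>s. s\<^sup>2) has_real_derivative 2 * x) (at x)" for x :: real
    by (auto intro!: derivative_eq_intros)
  have cosh_sq: "((\<lambda>s. (cosh s)\<^sup>2) has_real_derivative 2 * cosh x * sinh x) (at x)" for x :: real
    by (auto intro!: derivative_eq_intros)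
  note transform = partial_transform[OF open_U assms]
  consider "j \<noteq> l" | "j = 1" "l = 1" | "j = 2" "l = 2" | "j = 3" "l = 3"
    using exhaust_3[of j] by metis
  then show ?thesis
  proof cases
    case 1
    have "partial i (\<lambda>q. metric X q $ j $ l) p = partial i (\<lambda>_. 0) p"
      by (rule transform) (use 1 in \<open>simp add: metric_X\<close>)
    also have "\<dots> = 0"
      by (simp add: partial_def)
    moreover have "(i = a \<and> j = k \<and> l = k) = False" for a k
      using 1 by blast
    ultimately show ?thesis
      by (simp only: if_False)
  next
    case 2
    have "partial i (\<lambda>q. metric X q $ 1 $ 1) p = partial i (\<lambda>q. - 1 / (1 + (h (q $ 1))\<^sup>2) * 1 * 1) p"
      by (rule transform) (simp add: metric_X)
    with exhaust_3[of i] show ?thesis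
      by (elim disjE) (simp_all only: 2 partial_separated[OF g1 one one], simp_all)
  next
    case 3
    have "partial i (\<lambda>q. metric X q $ 2 $ 2) p = partial i (\<lambda>q. (q $ 1)\<^sup>2 * 1 * 1) p"
      by (rule transform) (simp add: metric_X)
    with exhaust_3[of i] show ?thesis
      by (elim disjE) (simp_all only: 3 partial_separated[OF sq one one], simp_all)
  next
    case 4
    have "partial i (\<lambda>q. metric X q $ 3 $ 3) p = partial i (\<lambda>q. (q $ 1)\<^sup>2 * (cosh (q $ 2))\<^sup>2 * 1) p"
      by (rule transform) (simp add: metric_X)
    with exhaust_3[of i] show ?thesis
      by (elim disjE) (simp_all only: 4 partial_separated[OF sq cosh_sq one], simp_all)
  qed
qed

lemma gradient_separated:
  assumes "p \<in> U" "\<And>q. q \<in> U \<Longrightarrow> \<phi> q = \<psi> (q $ 1) * a (q $ 2) * b (q $ 3)"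
    and "(\<psi> has_real_derivative \<psi>') (at (p $ 1))" "(a has_real_derivative a') (at (p $ 2))"
    "(b has_real_derivative b') (at (p $ 3))"
  shows "gradient X \<phi> p $ 1 = - (1 + (h (p $ 1))\<^sup>2) * \<psi>' * a (p $ 2) * b (p $ 3)"
    and "gradient X \<phi> p $ 2 = \<psi> (p $ 1) / (p $ 1)\<^sup>2 * a' * b (p $ 3)"
    and "gradient X \<phi> p $ 3 = \<psi> (p $ 1) / (p $ 1)\<^sup>2 * (a (p $ 2) / (cosh (p $ 2))\<^sup>2) * b'"
  using partial_separated[OF assms(3-5)] partial_transform[OF open_U assms(1,2)]
  by (simp_all add: gradient_def matrix_inv_metric_X[OF assms(1)] diag3_mult_vec)

text \<open>The Newton transformation is diagonal, so the trace sees only the diagonal of the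
  Hessian, and with it only the Christoffel symbols whose upper index equals a lower one.\<close>

lemma L_1_separated:
  assumes "p \<in> U" "\<And>q. q \<in> U \<Longrightarrow> \<phi> q = \<psi> (q $ 1) * a (q $ 2) * b (q $ 3)"
    and \<psi>: "\<And>s. s \<in> I \<Longrightarrow> (\<psi> has_real_derivative \<psi>' s) (at s)"
      "\<And>s. s \<in> I \<Longrightarrow> (\<psi>' has_real_derivative \<psi>'' s) (at s)"
    and a: "\<And>t. (a has_real_derivative a' t) (at t)" "\<And>t. (a' has_real_derivative a'' t) (at t)"
    and b: "\<And>t. (b has_real_derivative b' t) (at t)" "\<And>t. (b' has_real_derivative b'' t) (at t)"
  shows "L_op 1 X N \<phi> p = (let s = p $ 1; t = p $ 2; w = p $ 3 in
    2 * (h s / s) * ((1 + (h s)\<^sup>2) * \<psi>'' s + h s * h' s * \<psi>' s) * a t * b w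
    - (h' s + h s / s) * (\<psi> s / s\<^sup>2 * (a'' t * b w + a t * b'' w / (cosh t)\<^sup>2 + tanh t * a' t * b w)
        - 2 / s * (1 + (h s)\<^sup>2) * \<psi>' s * a t * b w))"
proof -
  have s: "p $ 1 \<in> I" "0 < p $ 1"
    using assms(1) pos by (auto simp: U_def)
  have grad: "gradient X \<phi> q $ 1 = - (1 + (h (q $ 1))\<^sup>2) * \<psi>' (q $ 1) * a (q $ 2) * b (q $ 3)"
    "gradient X \<phi> q $ 2 = \<psi> (q $ 1) / (q $ 1)\<^sup>2 * a' (q $ 2) * b (q $ 3)"
    "gradient X \<phi> q $ 3 = \<psi> (q $ 1) / (q $ 1)\<^sup>2 * (a (q $ 2) / (cosh (q $ 2))\<^sup>2) * b' (q $ 3)"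
    if "q \<in> U" for q
    using gradient_separated[where \<phi> = \<phi> and \<psi> = \<psi> and a = a and b = b, OF that assms(2) \<psi>(1) a(1) b(1)]
      that by (simp_all add: U_def)
  have "((\<lambda>s. - (1 + (h s)\<^sup>2) * \<psi>' s) has_real_derivative
      - 2 * h (p $ 1) * h' (p $ 1) * \<psi>' (p $ 1) - (1 + (h (p $ 1))\<^sup>2) * \<psi>'' (p $ 1)) (at (p $ 1))"
    using h_deriv[OF s(1)] \<psi>(2)[OF s(1)] by (auto intro!: derivative_eq_intros simp: algebra_simps)
  note partial_separated(1)[OF this a(1) b(1)]
  moreover have "partial 1 (\<lambda>q. gradient X \<phi> q $ 1) p =
      partial 1 (\<lambda>q. - (1 + (h (q $ 1))\<^sup>2) * \<psi>' (q $ 1) * a (q $ 2) * b (q $ 3)) p"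
    by (rule partial_transform[OF open_U assms(1) grad(1)])
  ultimately have 1: "partial 1 (\<lambda>q. gradient X \<phi> q $ 1) p =
      (- 2 * h (p $ 1) * h' (p $ 1) * \<psi>' (p $ 1) - (1 + (h (p $ 1))\<^sup>2) * \<psi>'' (p $ 1))
        * a (p $ 2) * b (p $ 3)"
    by simp
  have D: "((\<lambda>s. \<psi> s / s\<^sup>2) has_real_derivative
      \<psi>' (p $ 1) / (p $ 1)\<^sup>2 - 2 * \<psi> (p $ 1) / (p $ 1) ^ 3) (at (p $ 1))"
    using \<psi>(1)[OF s(1)] s(2)
    by (auto intro!: derivative_eq_intros simp: field_simps power2_eq_square power3_eq_cube)
  have "partial 2 (\<lambda>q. gradient X \<phi> q $ 2) p =
      partial 2 (\<lambda>q. \<psi> (q $ 1) / (q $ 1)\<^sup>2 * a' (q $ 2) * b (q $ 3)) p"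
    by (rule partial_transform[OF open_U assms(1) grad(2)])
  with partial_separated(2)[OF D a(2) b(1)]
  have 2: "partial 2 (\<lambda>q. gradient X \<phi> q $ 2) p = \<psi> (p $ 1) / (p $ 1)\<^sup>2 * a'' (p $ 2) * b (p $ 3)"
    by simp
  have "((\<lambda>t. a t / (cosh t)\<^sup>2) has_real_derivative
      (a' (p $ 2) * (cosh (p $ 2))\<^sup>2 - a (p $ 2) * (2 * cosh (p $ 2) * sinh (p $ 2)))
        / ((cosh (p $ 2))\<^sup>2 * (cosh (p $ 2))\<^sup>2)) (at (p $ 2))"
    by (rule DERIV_divide[OF a(1)]) (auto intro!: derivative_eq_intros)
  note partial_separated(3)[OF D this b(2)]
  moreover have "partial 3 (\<lambda>q. gradient X \<phi> q $ 3) p =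
      partial 3 (\<lambda>q. \<psi> (q $ 1) / (q $ 1)\<^sup>2 * (a (q $ 2) / (cosh (q $ 2))\<^sup>2) * b' (q $ 3)) p"
    by (rule partial_transform[OF open_U assms(1) grad(3)])
  ultimately have 3: "partial 3 (\<lambda>q. gradient X \<phi> q $ 3) p =
      \<psi> (p $ 1) / (p $ 1)\<^sup>2 * (a (p $ 2) / (cosh (p $ 2))\<^sup>2) * b'' (p $ 3)"
    by simp
  \<comment> \<open>With \<open>z = 1 + h\<^sup>2\<close> this evaluates the Christoffel symbol with
    all indices 1.\<close>
  have g1: "- z * (2 * x * y / z\<^sup>2) / 2 = - x * y / z" for x y z :: real
    by (simp add: power2_eq_square)
  have \<Gamma>: "christoffel X 1 1 l p = (if l = 1 then - h (p $ 1) * h' (p $ 1) / (1 + (h (p $ 1))\<^sup>2) else 0)"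
    "christoffel X 2 2 l p = (if l = 1 then 1 / p $ 1 else 0)"
    "christoffel X 3 3 l p = (if l = 1 then 1 / p $ 1 else if l = 2 then tanh (p $ 2) else 0)" for l
    using s(2) exhaust_3[of l] g1[of "1 + (h (p $ 1))\<^sup>2"]
    by (auto simp: christoffel_def matrix_inv_metric_X[OF assms(1)] sum_3
        partial_metric_X[OF assms(1)] tanh_def power2_eq_square[of "p $ 1"]
        power2_eq_square[of "cosh _"] mult.assoc)
  have hess: "hessian X \<phi> p $ 1 $ 1 =
      - ((1 + (h (p $ 1))\<^sup>2) * \<psi>'' (p $ 1) + h (p $ 1) * h' (p $ 1) * \<psi>' (p $ 1)) * a (p $ 2) * b (p $ 3)"
    "hessian X \<phi> p $ 2 $ 2 = \<psi> (p $ 1) / (p $ 1)\<^sup>2 * a'' (p $ 2) * b (p $ 3)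
      - 1 / p $ 1 * (1 + (h (p $ 1))\<^sup>2) * \<psi>' (p $ 1) * a (p $ 2) * b (p $ 3)"
    "hessian X \<phi> p $ 3 $ 3 = \<psi> (p $ 1) / (p $ 1)\<^sup>2 * (a (p $ 2) * b'' (p $ 3) / (cosh (p $ 2))\<^sup>2
          + tanh (p $ 2) * a' (p $ 2) * b (p $ 3))
      - 1 / p $ 1 * (1 + (h (p $ 1))\<^sup>2) * \<psi>' (p $ 1) * a (p $ 2) * b (p $ 3)"
  proof -
    define Q where "Q = 1 + (h (p $ 1))\<^sup>2"
    have "0 < Q"
      by (simp add: Q_def one_plus_h_sq_pos)
    note [simp] = hessian_def sum_3 1[folded Q_def] 2 3 \<Gamma>[folded Q_def] grad[OF assms(1), folded Q_def]
    show "hessian X \<phi> p $ 1 $ 1 =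
        - (Q * \<psi>'' (p $ 1) + h (p $ 1) * h' (p $ 1) * \<psi>' (p $ 1)) * a (p $ 2) * b (p $ 3)"
      using \<open>0 < Q\<close> by (simp add: algebra_simps)
    show "hessian X \<phi> p $ 2 $ 2 = \<psi> (p $ 1) / (p $ 1)\<^sup>2 * a'' (p $ 2) * b (p $ 3)
        - 1 / p $ 1 * Q * \<psi>' (p $ 1) * a (p $ 2) * b (p $ 3)"
      by simp
    show "hessian X \<phi> p $ 3 $ 3 = \<psi> (p $ 1) / (p $ 1)\<^sup>2 * (a (p $ 2) * b'' (p $ 3) / (cosh (p $ 2))\<^sup>2
          + tanh (p $ 2) * a' (p $ 2) * b (p $ 3))
        - 1 / p $ 1 * Q * \<psi>' (p $ 1) * a (p $ 2) * b (p $ 3)"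
      by (simp add: algebra_simps add_divide_distrib)
  qed
  have two: "2 / p $ 1 = 2 * (1 / p $ 1)"
    by simp
  \<comment> \<open>Here \<open>K\<close> is \<open>h / s\<close>, \<open>M\<close> is
    \<open>h' + h / s\<close>, \<open>P\<close> is \<open>\<psi> / s\<^sup>2\<close>,
    \<open>Q\<close> is \<open>1 + h\<^sup>2\<close>, \<open>i\<close> is \<open>1 / s\<close> and
    \<open>d\<close> is \<open>\<psi>'\<close>; stated for free variables, the identity matches the
    unfolded trace literally.\<close>
  have collect: "- 2 * K * (- A * x * y) + - M * (P * x'' * y - i * Q * d * x * y)
        + - M * (P * (x * y'' / C + T * x' * y) - i * Q * d * x * y)
      = 2 * K * A * x * y - M * (P * (x'' * y + x * y'' / C + T * x' * y) - 2 * i * Q * d * x * y)"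
    for K A M P Q C T i d x x' x'' y y'' :: real
    by (simp add: algebra_simps)
  show ?thesis
    unfolding L_op_def newton_1_X[OF assms(1)] trace_diag3_mult hess Let_def two
    by (rule collect)
qed

text \<open>The hypothesis on \<open>h''\<close> says that \<open>2 h h' / s + h\<^sup>2 / s\<^sup>2\<close>, which is \<open>a\<^sub>2\<close>, is constant.\<close>

lemma L_1_normal:
  assumes "p \<in> U" and h'': "\<And>s. s \<in> I \<Longrightarrow> h s * h'' s = (h s / s)\<^sup>2 - (h' s)\<^sup>2"
  shows "L_vec 1 X N N p = (let s = p $ 1 in
    (2 * (h s / s) * ((h' s)\<^sup>2 + h' s * (h s / s) + (h s / s)\<^sup>2)) *\<^sub>R N p)"
proof -
  \<comment> \<open>For the principal curvatures \<open>h'\<close>, \<open>h / s\<close>,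
    \<open>h / s\<close> with elementary symmetric functions \<open>e1\<close>, \<open>e2\<close>,
    \<open>e3\<close>, this factor is \<open>e1 * e2 - 3 * e3\<close>.\<close>
  let ?m = "2 * (h (p $ 1) / p $ 1) * ((h' (p $ 1))\<^sup>2 + h' (p $ 1) * (h (p $ 1) / p $ 1) + (h (p $ 1) / p $ 1)\<^sup>2)"
  have s: "p $ 1 \<in> I" "0 < p $ 1"
    using assms(1) pos by (auto simp: U_def)
  have h: "((\<lambda>s. - h s) has_real_derivative - h' s) (at s)"
    "((\<lambda>s. - h' s) has_real_derivative - h'' s) (at s)" if "s \<in> I" for s
    using h_deriv h'_deriv that by (auto intro!: derivative_eq_intros)
  note cosh = DERIV_cosh and sinh = DERIV_sinh
  have one: "((\<lambda>_. 1 :: real) has_real_derivative 0) (at t)"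
    and zero: "((\<lambda>_. 0 :: real) has_real_derivative 0) (at t)" for t :: real
    by simp_all
  \<comment> \<open>The radial identity shared by the first three components, where
    \<open>\<psi> = - h\<close> and the angular part contributes the factor 2.\<close>
  have radial: "2 * (h s / s) * ((1 + (h s)\<^sup>2) * - h'' s + h s * h' s * - h' s) * A * B
      - (h' s + h s / s) * (- h s / s\<^sup>2 * (2 * (A * B)) - 2 / s * (1 + (h s)\<^sup>2) * - h' s * A * B)
      = 2 * (h s / s) * ((h' s)\<^sup>2 + h' s * (h s / s) + (h s / s)\<^sup>2) * (- h s * A * B)"
    if "s \<in> I" for s A B
  proof -
    \<comment> \<open>In terms of \<open>k\<close> and \<open>i\<close> the hypothesis on
      \<open>h''\<close> and all fractions become polynomial relations, as \<open>algebra\<close>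
      needs.\<close>
    define k i where "k = h s / s" and "i = 1 / s"
    have *: "h s = k * s" "i * s = 1" "k * h'' s = i * (k\<^sup>2 - (h' s)\<^sup>2)" "- h s / s\<^sup>2 = - (k * i)" "2 / s = 2 * i"
      using h''[OF that] pos[OF that] by (simp_all add: k_def i_def power2_eq_square)
    show ?thesis
      unfolding k_def[symmetric] *(4,5) using *(1-3) by algebra
  qed
  \<comment> \<open>The coordinate functions of the hyperbolic plane are eigenfunctions of its
    Laplacian with eigenvalue 2; \<open>angular\<close> covers the first and third coordinates,
    \<open>angular_1\<close> the second.\<close>
  have angular: "cosh t * B + cosh t * B / (cosh t)\<^sup>2 + tanh t * sinh t * B = 2 * (cosh t * B)" for t B :: real
  proof -
    have "cosh t * B / (cosh t)\<^sup>2 + tanh t * sinh t * B = ((sinh t)\<^sup>2 + 1) / cosh t * B"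
      by (simp add: tanh_def field_simps power2_eq_square)
    also have "\<dots> = cosh t * B"
      unfolding cosh_square_eq[symmetric] by (simp add: power2_eq_square)
    finally show ?thesis
      by simp
  qed
  have angular_1: "sinh t * 1 + sinh t * 0 / (cosh t)\<^sup>2 + tanh t * cosh t * 1 = 2 * (sinh t * 1)" for t :: real
    by (simp add: tanh_def)
  note L = L_1_separated[OF assms(1)] and comp = normal_eq vector_4
  have "L_op 1 X N (\<lambda>q. N q $ 1) p = ?m * N p $ 1"
  proof -
    have "N q $ 1 = - h (q $ 1) * cosh (q $ 2) * cosh (q $ 3)" if "q \<in> U" for q
      by (simp add: comp that)
    note L[where \<phi> = "\<lambda>q. N q $ 1" and \<psi> = "\<lambda>s. - h s" and a = cosh and b = cosh,
        OF this h cosh sinh cosh sinh]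
    from this[unfolded Let_def angular radial[OF s(1)]] show ?thesis
      by (simp add: comp assms(1))
  qed
  moreover have "L_op 1 X N (\<lambda>q. N q $ 2) p = ?m * N p $ 2"
  proof -
    have "N q $ 2 = - h (q $ 1) * sinh (q $ 2) * 1" if "q \<in> U" for q
      by (simp add: comp that)
    note L[where \<phi> = "\<lambda>q. N q $ 2" and \<psi> = "\<lambda>s. - h s" and a = sinh and b = "\<lambda>_. 1",
        OF this h sinh cosh one zero]
    from this[unfolded Let_def angular_1 radial[OF s(1)]] show ?thesis
      by (simp add: comp assms(1))
  qed
  moreover have "L_op 1 X N (\<lambda>q. N q $ 3) p = ?m * N p $ 3"
  proof -
    have "N q $ 3 = - h (q $ 1) * cosh (q $ 2) * sinh (q $ 3)" if "q \<in> U" for q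
      by (simp add: comp that)
    note L[where \<phi> = "\<lambda>q. N q $ 3" and \<psi> = "\<lambda>s. - h s" and a = cosh and b = sinh,
        OF this h cosh sinh sinh cosh]
    from this[unfolded Let_def angular radial[OF s(1)]] show ?thesis
      by (simp add: comp assms(1))
  qed
  moreover have "L_op 1 X N (\<lambda>q. N q $ 4) p = ?m * N p $ 4"
  proof -
    \<comment> \<open>The last component has no angular dependence, so it is treated with constant
      angular factors and radial part \<open>- r\<close>.\<close>
    define r where "r s = sqrt (1 + (h s)\<^sup>2)" for s
    have r: "0 < r s" "(r s)\<^sup>2 = 1 + (h s)\<^sup>2" for s
      using one_plus_h_sq_pos[of s] by (simp_all add: r_def)
    have r': "(r has_real_derivative h s * h' s / r s) (at s)" if "s \<in> I" for s
      using DERIV_minus[OF sqrt_h_deriv[OF that]] by (simp add: r_def[abs_def])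
    define \<psi>'' where "\<psi>'' s = - (((h' s * h' s + h'' s * h s) * r s - h s * h' s * (h s * h' s / r s))
      / (r s * r s))" for s
    have "((\<lambda>s. - r s) has_real_derivative - (h s * h' s / r s)) (at s)"
      "((\<lambda>s. - (h s * h' s / r s)) has_real_derivative \<psi>'' s) (at s)" if "s \<in> I" for s
      using r(1)[of s] unfolding \<psi>''_def
      by (intro DERIV_minus DERIV_divide DERIV_mult' DERIV_mult h_deriv h'_deriv r' that; simp)+
    note L = L[where \<phi> = "\<lambda>q. N q $ 4" and a = "\<lambda>_. 1" and b = "\<lambda>_. 1", OF _ this one zero one zero]
    have "L_op 1 X N (\<lambda>q. N q $ 4) p = (let s = p $ 1 in
        2 * (h s / s) * ((1 + (h s)\<^sup>2) * \<psi>'' s + h s * h' s * - (h s * h' s / r s))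
        + (h' s + h s / s) * (2 / s * (1 + (h s)\<^sup>2) * - (h s * h' s / r s)))"
      by (subst L) (simp_all add: comp r_def Let_def)
    also have "\<dots> = ?m * - r (p $ 1)"
    proof -
      \<comment> \<open>Again everything becomes polynomial, with \<open>j\<close> standing for the
        inverse of \<open>r s\<close>.\<close>
      define s k i j where "s = p $ 1" and "k = h s / s" and "i = 1 / s" and "j = 1 / r s"
      have *: "h s = k * s" "i * s = 1" "k * h'' s = i * (k\<^sup>2 - (h' s)\<^sup>2)" "2 / s = 2 * i"
        "j * r s = 1" "h s * h' s / r s = h s * h' s * j"
        "\<psi>'' s = - (((h' s * h' s + h'' s * h s) * r s - h s * h' s * (h s * h' s * j)) * j\<^sup>2)"
        using h''[of s] r(1)[of s] assms(1) pos[of s]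
        by (simp_all add: k_def i_def j_def \<psi>''_def power2_eq_square U_def s_def)
      show ?thesis
        unfolding Let_def s_def[symmetric] k_def[symmetric] *(4,6,7)
        using *(1-3,5) r(2)[of s] by algebra
    qed
    finally show ?thesis
      by (simp add: comp assms(1) r_def)
  qed
  ultimately show ?thesis
    by (simp add: L_vec_def vec_eq_iff forall_4 Let_def)
qed

lemma first_kind_X:
  assumes "smooth_fun_on (\<lambda>p. h (p $ 1)) U" "smooth_fun_on m U" "\<And>p. p \<in> U \<Longrightarrow> m p \<noteq> 0"
    and "\<And>s. s \<in> I \<Longrightarrow> h s * h'' s = (h s / s)\<^sup>2 - (h' s)\<^sup>2"
    and "\<And>p s. p \<in> U \<Longrightarrow> s = p $ 1 \<Longrightarrow>
      m p = 2 * (h s / s) * ((h' s)\<^sup>2 + h' s * (h s / s) + (h s / s)\<^sup>2)"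
  shows "first_kind_pointwise_1_type 1 U X N m"
  using assms(1-3) oriented_hypersurface_X L_1_normal[OF _ assms(4)] assms(5)
  by (simp add: first_kind_pointwise_1_type_def Let_def)

end

section \<open>The explicit family of profile curves\<close>

theorem theorem2:
  fixes c4 c5 c6 \<sigma> :: real
    and f :: "real \<Rightarrow> real" and U :: "(real^3) set" and m :: "real^3 \<Rightarrow> real"
  assumes "\<sigma> = 1 \<or> \<sigma> = - 1"
  defines "f \<equiv> profile \<sigma> c4 c5 c6"
    and "U \<equiv> {p. p $ 1 \<in> profile_domain c4 c5}"
    and "m \<equiv> (\<lambda>p. let s = p $ 1 in
           \<sigma> * (c4\<^sup>2 * sqrt 2 * (1 + 12 * c5 * s ^ 3 * (1 + 12 * c5 * s ^ 3)))
             / (s powr (9 / 2) * sqrt (3 * c4 * (1 + 6 * c5 * s ^ 3))))"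
  shows "first_kind_pointwise_1_type 1 U (rot_surface f) (rot_normal f) m \<and>
    (\<forall>p\<in>U. let s = p $ 1; t = p $ 2; w = p $ 3 in
       L_vec 1 (rot_surface f) (rot_normal f) (rot_normal f) p =
       (2 * (1 + 12 * c5 * s ^ 3 * (1 + 12 * c5 * s ^ 3)) / (- 3 * c4 powi (- 2) * s ^ 5)) *\<^sub>R
         vector [cosh t * cosh w, sinh t, cosh t * sinh w,
           sqrt (12 * c4 * c5 * s ^ 3 + 3 * s + 2 * c4) /
             (\<sigma> * sqrt (2 * c4 * (1 + 6 * c5 * s ^ 3)))])"
proof -
  \<comment> \<open>\<open>q\<close> is \<open>h\<^sup>2\<close>\<close>
  define q q' where "q s = 2 * c4 * (1 + 6 * c5 * s ^ 3) / (3 * s)"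
    and "q' s = 2 * c4 / 3 * (12 * c5 * s - 1 / s\<^sup>2)" for s
  define Y where "Y s = 1 + 12 * c5 * s ^ 3 * (1 + 12 * c5 * s ^ 3)" for s
  define M where "M s = 2 * c4\<^sup>2 * Y s / (3 * s ^ 5)" for s
  have \<sigma>: "\<sigma> * \<sigma> = 1" "\<sigma>\<^sup>2 = 1"
    using assms(1) by auto
  have domain: "0 < s" "0 < c4 * (1 + 6 * c5 * s ^ 3)" "0 < q s" if "s \<in> profile_domain c4 c5" for s
    using that by (auto simp: profile_domain_def q_def mult.assoc)
  have pos: "0 < p $ 1" "0 < c4 * (1 + 6 * c5 * (p $ 1) ^ 3)" "0 < q (p $ 1)" if "p \<in> U" for p
    using domain[of "p $ 1"] that by (simp_all add: U_def)
  \<comment> \<open>The function \<open>h\<close> is the signed root of \<open>q\<close>, and the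
    other two arguments are its first and second derivatives, with \<open>2 * q / s\<^sup>2\<close>
    substituted for the second derivative of \<open>q\<close>.\<close>
  interpret R: rotational_hypersurface "profile_domain c4 c5" f "\<lambda>s. \<sigma> * sqrt (q s)"
    "\<lambda>s. \<sigma> * (q' s / (2 * sqrt (q s)))" "\<lambda>s. \<sigma> * ((q s / s\<^sup>2 - (q' s)\<^sup>2 / (4 * q s)) / sqrt (q s))"
  proof
    fix s assume s: "s \<in> profile_domain c4 c5"
    note s_pos = domain(1)[OF s] and q_pos = domain(3)[OF s]
    \<comment> \<open>The second derivative of \<open>q\<close> is \<open>2 * q / s\<^sup>2\<close>:
      an Euler equation with solutions \<open>s\<^sup>2\<close> and \<open>1 / s\<close>, of which
      \<open>q\<close> is a combination.\<close>
    have D: "(q has_real_derivative q' s) (at s)" "(q' has_real_derivative 2 * q s / s\<^sup>2) (at s)"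
      unfolding q_def[abs_def] q'_def[abs_def] using s_pos
      by (auto intro!: derivative_eq_intros simp: field_simps power2_eq_square power3_eq_cube)
    show "0 < s"
      by (rule s_pos)
    \<comment> \<open>Numerator and denominator of the integrand share the factor
      \<open>3 * s\<close> under the roots, which leaves
      \<open>sqrt (q s) / sqrt (1 + q s)\<close>.\<close>
    have "2 * (6 * c4 * c5 * s ^ 3 + c4) = 3 * s * q s"
      "12 * c4 * c5 * s ^ 3 + 3 * s + 2 * c4 = 3 * s * (1 + q s)"
      using s_pos by (simp_all add: q_def field_simps)
    with profile_deriv[OF s, of \<sigma> c6] s_pos
    have "(f has_real_derivative \<sigma> * (sqrt (q s) / sqrt (1 + q s))) (at s)"
      by (simp add: f_def real_sqrt_mult)
    with q_pos \<sigma>(2) show "(f has_real_derivative \<sigma> * sqrt (q s) / sqrt (1 + (\<sigma> * sqrt (q s))\<^sup>2)) (at s)"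
      by (simp add: power_mult_distrib)
    have sqrt: "((\<lambda>s. sqrt (q s)) has_real_derivative q' s / (2 * sqrt (q s))) (at s)"
      using D(1) q_pos by (auto intro!: derivative_eq_intros simp: field_simps)
    then show "((\<lambda>s. \<sigma> * sqrt (q s)) has_real_derivative \<sigma> * (q' s / (2 * sqrt (q s)))) (at s)"
      by (rule DERIV_cmult)
    have "((\<lambda>s. q' s / (2 * sqrt (q s))) has_real_derivative
        (2 * q s / s\<^sup>2 * (2 * sqrt (q s)) - q' s * (2 * (q' s / (2 * sqrt (q s)))))
          / (2 * sqrt (q s) * (2 * sqrt (q s)))) (at s)"
      using q_pos by (intro DERIV_divide D DERIV_cmult sqrt) simp
    moreover have quotient: "(2 * (r * r) / s\<^sup>2 * (2 * r) - q' s * (2 * (q' s / (2 * r)))) / (2 * r * (2 * r))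
        = (r * r / s\<^sup>2 - (q' s)\<^sup>2 / (4 * (r * r))) / r" if "0 < r" for r
      using that s_pos by (simp add: field_simps power2_eq_square)
    ultimately show "((\<lambda>s. \<sigma> * (q' s / (2 * sqrt (q s)))) has_real_derivative
        \<sigma> * ((q s / s\<^sup>2 - (q' s)\<^sup>2 / (4 * q s)) / sqrt (q s))) (at s)"
      using q_pos quotient[of "sqrt (q s)"] by (intro DERIV_cmult) simp
  qed (rule open_profile_domain)
  have U: "U = R.U"
    by (simp add: U_def R.U_def)
  have m_eq: "2 * (\<sigma> * sqrt (q s) / s) * ((\<sigma> * (q' s / (2 * sqrt (q s))))\<^sup>2
      + \<sigma> * (q' s / (2 * sqrt (q s))) * (\<sigma> * sqrt (q s) / s) + (\<sigma> * sqrt (q s) / s)\<^sup>2) = m p"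
    (is "?m = _") and m_M: "m p = \<sigma> * M s / sqrt (q s)" if "p \<in> U" "s = p $ 1" for p s
  proof -
    \<comment> \<open>The surds become variables with polynomial relations for their squares, so
      that the comparison with \<open>m\<close> can be left to \<open>algebra\<close>.\<close>
    define r u w where "r = sqrt s" and "u = sqrt (3 * (c4 * (1 + 6 * c5 * s ^ 3)))" and "w = sqrt (2 :: real)"
    have s: "0 < s"
      using pos(1) that by simp
    have pos': "0 < r" "0 < u" "0 < w"
      using pos that by (simp_all add: r_def u_def w_def)
    have sq: "s = r\<^sup>2" "w\<^sup>2 = 2"
      using s by (simp_all add: r_def w_def)
    have u_sq: "u\<^sup>2 = 3 * (c4 * (1 + 6 * c5 * (r\<^sup>2) ^ 3))"
      using pos(2)[OF that(1)] by (simp add: u_def that(2) flip: sq(1)[unfolded that(2)])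
    have "q s = 2 * (3 * (c4 * (1 + 6 * c5 * s ^ 3))) / (9 * s)"
      using s by (simp add: q_def field_simps)
    then have q_eq: "sqrt (q s) = w * u / (3 * r)"
      by (simp only: real_sqrt_mult real_sqrt_divide u_def r_def w_def) simp
    have "?m = \<sigma> * (c4\<^sup>2 * w * Y s) / (s ^ 4 * r * u)"
      unfolding q_eq unfolding q'_def Y_def sq(1) using pos'
      by (simp add: divide_simps) (use u_sq \<sigma>(2) sq(2) in algebra)
    moreover have "\<sigma> * M s / sqrt (q s) = \<sigma> * (c4\<^sup>2 * w * Y s) / (s ^ 4 * r * u)"
    proof -
      have "M s = w * w * c4\<^sup>2 * Y s / (3 * (s ^ 4 * (r * r)))"
        using sq by (simp add: M_def flip: power2_eq_square)
      with s pos' show ?thesis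
        unfolding q_eq by (simp only:) (simp add: field_simps)
    qed
    moreover have "s powr (9 / 2) = s ^ 4 * r"
    proof -
      have "s powr (9 / 2) = s powr (real 4 + 1 / 2)"
        by simp
      also have "\<dots> = s ^ 4 * r"
        using s by (simp only: powr_add powr_realpow powr_half_sqrt less_imp_le r_def)
      finally show ?thesis .
    qed
    ultimately show "?m = m p" "m p = \<sigma> * M s / sqrt (q s)"
      by (simp_all add: m_def Let_def that(2) Y_def u_def w_def mult.assoc)
  qed
  \<comment> \<open>Constancy of the second symmetric function of the curvatures:
    \<open>h * h'' + h'\<^sup>2\<close> is half the second derivative of \<open>q\<close>, hence
    \<open>q / s\<^sup>2\<close>.\<close>
  have h'': "\<sigma> * sqrt (q s) * (\<sigma> * ((q s / s\<^sup>2 - (q' s)\<^sup>2 / (4 * q s)) / sqrt (q s)))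
      = (\<sigma> * sqrt (q s) / s)\<^sup>2 - (\<sigma> * (q' s / (2 * sqrt (q s))))\<^sup>2"
    if "s \<in> profile_domain c4 c5" for s
  proof -
    have "0 < q s"
      by (rule domain(3)[OF that])
    then have "\<sigma> * sqrt (q s) * (\<sigma> * (x / sqrt (q s))) = (\<sigma> * \<sigma>) * x" for x
      by simp
    with \<open>0 < q s\<close> show ?thesis
      by (simp add: \<sigma> power_mult_distrib power_divide)
  qed
  have smooth_h: "smooth_fun_on (\<lambda>p. \<sigma> * sqrt (q (p $ 1))) R.U"
    unfolding q_def
    by (intro smooth_fun_on_mult smooth_fun_on_divide smooth_fun_on_sqrt smooth_fun_on_add
        smooth_fun_on_power smooth_fun_on_const smooth_fun_on_coordinate R.open_U)
      (use pos in \<open>simp_all add: U mult.assoc\<close>)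
  have smooth_m: "smooth_fun_on m U"
    unfolding m_def Let_def U
    by (intro smooth_fun_on_mult smooth_fun_on_divide smooth_fun_on_sqrt smooth_fun_on_add
        smooth_fun_on_power smooth_fun_on_const smooth_fun_on_coordinate smooth_fun_on_powr R.open_U)
      (use pos less_imp_neq[OF pos(1)] in \<open>auto simp: U mult.assoc intro!: mult_pos_pos\<close>)
  have m_nonzero: "m p \<noteq> 0" if "p \<in> U" for p
  proof -
    \<comment> \<open>Positivity of this quadratic keeps \<open>Y\<close> away from zero, so
      \<open>m\<close> has the constant sign of \<sigma>.\<close>
    have "0 < 1 + x * (1 + x)" for x :: real
    proof -
      have "1 + x * (1 + x) = (x + 1 / 2)\<^sup>2 + 3 / 4"
        by (simp add: power2_eq_square algebra_simps)
      then show ?thesis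
        using zero_le_power2[of "x + 1 / 2"] by linarith
    qed
    from this[of "12 * c5 * (p $ 1) ^ 3"] have "0 < Y (p $ 1)"
      by (simp add: Y_def)
    moreover have "c4 \<noteq> 0" "\<sigma> \<noteq> 0"
      using pos(2)[OF that] assms(1) by auto
    ultimately show ?thesis
      using pos[OF that] by (simp add: m_M[OF that refl] M_def)
  qed
  have first_kind: "first_kind_pointwise_1_type 1 U (rot_surface f) (rot_normal f) m"
    by (rule R.first_kind_X[folded U, OF smooth_h[folded U] smooth_m])
      (erule m_nonzero, erule h'', erule (1) m_eq[symmetric])
  then have L: "L_vec 1 (rot_surface f) (rot_normal f) (rot_normal f) p = m p *\<^sub>R rot_normal f p"
    if "p \<in> U" for p
    using that by (simp add: first_kind_pointwise_1_type_def)
  have "L_vec 1 (rot_surface f) (rot_normal f) (rot_normal f) p =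
      (2 * Y s / (- 3 * c4 powi (- 2) * s ^ 5)) *\<^sub>R
        vector [cosh t * cosh w, sinh t, cosh t * sinh w,
          sqrt (12 * c4 * c5 * s ^ 3 + 3 * s + 2 * c4) / (\<sigma> * sqrt (2 * c4 * (1 + 6 * c5 * s ^ 3)))]"
    if "p \<in> U" "s = p $ 1" "t = p $ 2" "w = p $ 3" for p s t w
  proof -
    have s: "0 < s" "0 < q s"
      using pos[OF that(1)] that(2) by simp_all
    have c: "2 * Y s / (- 3 * c4 powi (- 2) * s ^ 5) = - M s"
      by (simp add: M_def power_int_minus field_simps)
    have "2 * c4 * (1 + 6 * c5 * s ^ 3) = 3 * s * q s"
      "12 * c4 * c5 * s ^ 3 + 3 * s + 2 * c4 = 3 * s * (1 + q s)"
      using s by (simp_all add: q_def field_simps)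
    then have "sqrt (12 * c4 * c5 * s ^ 3 + 3 * s + 2 * c4) / (\<sigma> * sqrt (2 * c4 * (1 + 6 * c5 * s ^ 3)))
        = \<sigma> * sqrt (1 + q s) / sqrt (q s)"
      using s assms(1) by (simp only: real_sqrt_mult) auto
    \<comment> \<open>In the first three components the sign in \<open>m\<close> cancels against the
      sign of \<open>h\<close> in the Gauss map, leaving the scalar \<open>- M s\<close>; only the
      last component keeps \<sigma>.\<close>
    moreover have "\<sigma> * M s / sqrt (q s) * - (\<sigma> * sqrt (q s)) = - M s"
      using s \<sigma>(1) by (simp add: field_simps)
    moreover have "(\<sigma> * sqrt (q s))\<^sup>2 = q s"
      using s \<sigma>(2) by (simp add: power_mult_distrib)
    ultimately show ?thesis
      using that(1) s(2) \<sigma>(1) unfolding c L[OF that(1)] m_M[OF that(1,2)]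
      by (simp add: R.normal_eq U that(2-4)[symmetric] vec_eq_iff forall_4 vector_4 mult.assoc[symmetric])
  qed
  with first_kind show ?thesis
    by (simp add: Let_def Y_def)
qed

end
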